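(* Let $0<r<1$ and let $T$ be an invertible bounded operator on a complex Hilbert space $\mathcal H$. Then the following are equivalent: (1) $T\in\mathbb{Q}\mathbb{A}_r$; (2) $(r^{-2}+r^2)I_{\mathcal H}-T^*T-T^{-1}(T^{-1})^*\ge0$; (3) $\overline{\mathbb A}_r$ is a spectral set for $(T^*T)^{1/2}$; (4) there exist an operator $P$ on $\mathcal H$ having $\overline{\mathbb A}_r$ as a spectral set and a unitary $U$ on $\mathcal H$ such that $T=UP$.
   Context: All operators are bounded linear operators on complex Hilbert spaces. $\mathbb A_r=\{z\in\mathbb C: r<|z|<r^{-1}\}$, $\overline{\mathbb A}_r=\{r\le|z|\le r^{-1}\}$. The quantum annulus $\mathbb{Q}\mathbb{A}_r$ is the class of invertible operators $T$ with $\|rT\|\le1$ and $\|rT^{-1}\|\le1$. A compact set $K\subset\mathbb C$ is a spectral set for an operator $T$ if $\sigma(T)\subseteq K$ and $\|f(T)\|\le\sup_{z\in K}|f(z)|$ for every rational function $f=p/q$ with poles off $K$, where $f(T)=p(T)q(T)^{-1}$. *)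

theory Defs
  imports "HOL-Analysis.Analysis" "HOL-Computational_Algebra.Polynomial"
begin

section \<open>Complex Hilbert spaces\<close>

text \<open>
  A complex inner product space is a real one (for the real inner product
  \<open>Re \<langle>x, y\<rangle>\<close>, which induces the same norm) equipped with a compatible complex scalar
  multiplication and a sesquilinear form, linear in its first argument.  Definiteness and
  \<open>norm x = sqrt (Re (cinner x x))\<close> come from \<open>real_inner\<close> through \<open>inner_eq_Re_cinner\<close>.
\<close>

class complex_inner = real_inner +
  fixes scaleC :: "complex \<Rightarrow> 'a \<Rightarrow> 'a" (infixr "*\<^sub>C" 75)
    and cinner :: "'a \<Rightarrow> 'a \<Rightarrow> complex"
  assumes scaleC_add_right: "c *\<^sub>C (x + y) = c *\<^sub>C x + c *\<^sub>C y"
    and scaleC_add_left: "(c + d) *\<^sub>C x = c *\<^sub>C x + d *\<^sub>C x"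
    and scaleC_scaleC: "c *\<^sub>C d *\<^sub>C x = (c * d) *\<^sub>C x"
    and scaleR_scaleC: "s *\<^sub>R x = complex_of_real s *\<^sub>C x"
    and cinner_commute: "cinner x y = cnj (cinner y x)"
    and cinner_add_left: "cinner (x + y) z = cinner x z + cinner y z"
    and cinner_scaleC_left: "cinner (c *\<^sub>C x) y = c * cinner x y"
    and inner_eq_Re_cinner: "inner x y = Re (cinner x y)"

class chilbert_space = complex_inner + banach

instantiation complex :: chilbert_space
begin

definition scaleC_complex :: "complex \<Rightarrow> complex \<Rightarrow> complex"
  where "scaleC_complex c x = c * x"

definition cinner_complex :: "complex \<Rightarrow> complex \<Rightarrow> complex"
  where "cinner_complex x y = x * cnj y"

instance
  by standard
    (auto simp: scaleC_complex_def cinner_complex_def algebra_simps scaleR_conv_of_real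
      inner_complex_def)

end

section \<open>Bounded operators\<close>

definition bounded_clinear :: "('a::complex_inner \<Rightarrow> 'b::complex_inner) \<Rightarrow> bool"
  where "bounded_clinear T \<longleftrightarrow> bounded_linear T \<and> (\<forall>c x. T (c *\<^sub>C x) = c *\<^sub>C T x)"

definition invertible_op :: "('a::complex_inner \<Rightarrow> 'a) \<Rightarrow> bool"
  where "invertible_op T \<longleftrightarrow> bounded_clinear T \<and>
    (\<exists>S. bounded_clinear S \<and> S \<circ> T = id \<and> T \<circ> S = id)"

definition cadjoint :: "('a::complex_inner \<Rightarrow> 'a) \<Rightarrow> 'a \<Rightarrow> 'a"
  where "cadjoint T = (THE S. \<forall>x y. cinner (T x) y = cinner x (S y))"

definition unitary_op :: "('a::complex_inner \<Rightarrow> 'a) \<Rightarrow> bool"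
  where "unitary_op U \<longleftrightarrow> bounded_clinear U \<and> cadjoint U \<circ> U = id \<and> U \<circ> cadjoint U = id"

definition positive_op :: "('a::complex_inner \<Rightarrow> 'a) \<Rightarrow> bool"
  where "positive_op A \<longleftrightarrow> bounded_clinear A \<and> (\<forall>x. cinner (A x) x \<in> \<real>\<^sub>\<ge>\<^sub>0)"

text \<open>Meaningful for positive \<open>A\<close> on a Hilbert space, where the positive square root exists
  and is unique.\<close>

definition sqrt_op :: "('a::complex_inner \<Rightarrow> 'a) \<Rightarrow> 'a \<Rightarrow> 'a"
  where "sqrt_op A = (THE S. positive_op S \<and> S \<circ> S = A)"

definition spectrum :: "('a::complex_inner \<Rightarrow> 'a) \<Rightarrow> complex set"
  where "spectrum T = {z. \<not> invertible_op (\<lambda>x. z *\<^sub>C x - T x)}"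

section \<open>Spectral sets and the quantum annulus\<close>

definition poly_op :: "complex poly \<Rightarrow> ('a::complex_inner \<Rightarrow> 'a) \<Rightarrow> 'a \<Rightarrow> 'a"
  where "poly_op p T x = (\<Sum>i\<le>degree p. coeff p i *\<^sub>C (T ^^ i) x)"

text \<open>
  A rational function with poles off \<open>K\<close> is represented by a pair of polynomials \<open>p\<close>, \<open>q\<close>
  such that \<open>q\<close> does not vanish on \<open>K\<close> (cancelling common factors gives such a pair).
  Then \<open>q(T)\<close> is invertible whenever the spectrum of \<open>T\<close> lies in \<open>K\<close>, so \<open>inv\<close>
  is the operator inverse.
  The supremum is intended for nonempty \<open>K\<close>.
\<close>

definition spectral_set :: "complex set \<Rightarrow> ('a::complex_inner \<Rightarrow> 'a) \<Rightarrow> bool"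
  where "spectral_set K T \<longleftrightarrow> compact K \<and> bounded_clinear T \<and> spectrum T \<subseteq> K \<and>
    (\<forall>p q. (\<forall>z\<in>K. poly q z \<noteq> 0) \<longrightarrow>
      onorm (poly_op p T \<circ> inv (poly_op q T)) \<le> (SUP z\<in>K. cmod (poly p z / poly q z)))"

definition closed_annulus :: "real \<Rightarrow> complex set"
  where "closed_annulus r = {z. r \<le> cmod z \<and> cmod z \<le> inverse r}"

definition quantum_annulus :: "real \<Rightarrow> ('a::complex_inner \<Rightarrow> 'a) set"
  where "quantum_annulus r = {T. invertible_op T \<and>
    onorm (\<lambda>x. r *\<^sub>R T x) \<le> 1 \<and> onorm (\<lambda>x. r *\<^sub>R inv T x) \<le> 1}"

end

theory Submission
  imports Defs "HOL-Computational_Algebra.Fundamental_Theorem_Algebra"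
begin

text \<open>
  As \<open>T\<^sup>-\<^sup>*\<close> is bounded below by \<open>1 / \<parallel>T\<parallel>\<close>, (2) forces \<open>\<parallel>T\<parallel>\<^sup>2 + \<parallel>T\<parallel>\<^sup>-\<^sup>2 \<le> r\<^sup>-\<^sup>2 + r\<^sup>2\<close>, and likewise for \<open>T\<^sup>-\<^sup>1\<close>.
  Conversely, (1) gives \<open>r\<^sup>2 \<le> B \<le> r\<^sup>-\<^sup>2\<close> for \<open>B = T T\<^sup>*\<close>, hence \<open>(r\<^sup>-\<^sup>2 - B) (B - r\<^sup>2) \<ge> 0\<close>, which is (2)
  conjugated by \<open>T\<^sup>*\<close>.  For (3), a polynomial that is nonnegative on \<open>[a, b]\<close> takes a self-adjoint
  operator \<open>a \<le> P \<le> b\<close> to a positive operator; applied to \<open>M\<^sup>2 \<bar>q\<bar>\<^sup>2 - \<bar>p\<bar>\<^sup>2\<close> this bounds \<open>p(P) q(P)\<^sup>-\<^sup>1\<close>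
  by the supremum \<open>M\<close> of \<open>p / q\<close>, and with Weierstrass approximation it also yields the square root.
  Conditions (3) and (4) return to (1) by testing the rational functions \<open>z\<close> and \<open>1 / z\<close>.
\<close>

section \<open>Complex inner products and bounded operators\<close>

lemma scaleC_zero_left [simp]: "0 *\<^sub>C x = 0"
  by (metis scaleR_scaleC of_real_0 scale_zero_left)

lemma scaleC_one [simp]: "1 *\<^sub>C x = x"
  by (metis scaleR_scaleC of_real_1 scaleR_one)

lemma scaleC_zero_right [simp]: "c *\<^sub>C 0 = 0"
  by (metis scaleC_scaleC scaleC_zero_left mult_zero_right)

lemma scaleC_minus_left: "(- c) *\<^sub>C x = - (c *\<^sub>C x)"
  by (metis add.left_inverse add_eq_0_iff scaleC_add_left scaleC_zero_left)

lemma scaleC_minus_right: "c *\<^sub>C (- x) = - (c *\<^sub>C x)"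
  by (metis add.left_inverse add_eq_0_iff scaleC_add_right scaleC_zero_right)

lemma scaleC_diff_right: "c *\<^sub>C (x - y) = c *\<^sub>C x - c *\<^sub>C y"
  by (metis diff_conv_add_uminus scaleC_add_right scaleC_minus_right)

lemma cinner_add_right: "cinner x (y + z) = cinner x y + cinner x z"
  by (metis cinner_add_left cinner_commute complex_cnj_add)

lemma cinner_scaleC_right: "cinner x (c *\<^sub>C y) = cnj c * cinner x y"
  by (metis cinner_scaleC_left cinner_commute complex_cnj_mult)

lemma cinner_minus_left: "cinner (- x) y = - cinner x y"
  using cinner_scaleC_left[of "-1" x y] by (simp add: scaleC_minus_left)

lemma cinner_minus_right: "cinner x (- y) = - cinner x y"
  by (metis cinner_minus_left cinner_commute complex_cnj_minus)

lemma cinner_diff_left: "cinner (x - y) z = cinner x z - cinner y z"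
  by (metis diff_conv_add_uminus cinner_add_left cinner_minus_left)

lemma cinner_diff_right: "cinner x (y - z) = cinner x y - cinner x z"
  by (metis diff_conv_add_uminus cinner_add_right cinner_minus_right)

lemma cinner_zero_left [simp]: "cinner 0 x = 0"
  using cinner_scaleC_left[of 0 0 x] by simp

lemma cinner_zero_right [simp]: "cinner x 0 = 0"
  using cinner_scaleC_right[of x 0 0] by simp

lemma cinner_self: "cinner x x = complex_of_real ((norm x)\<^sup>2)"
proof -
  have "cnj (cinner x x) = cinner x x" using cinner_commute[of x x] by simp
  then have "Im (cinner x x) = 0" by (simp add: complex_eq_iff)
  then show ?thesis
    by (simp add: complex_eq_iff inner_eq_Re_cinner[symmetric] power2_norm_eq_inner)
qed

text \<open>The imaginary part of a complex number is the real part of its product with -i. Hence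
  the real form determines the complex one, and identities for \<open>inner\<close> lift to
  \<open>cinner\<close>.\<close>

lemma cinner_eq_inner: "cinner x y = Complex (inner x y) (inner (- (\<i> *\<^sub>C x)) y)"
  by (simp add: complex_eq_iff inner_eq_Re_cinner cinner_minus_left cinner_scaleC_left)

lemma norm_scaleC [simp]: "norm (c *\<^sub>C x) = cmod c * norm x"
proof -
  have "complex_of_real ((norm (c *\<^sub>C x))\<^sup>2) = c * cnj c * complex_of_real ((norm x)\<^sup>2)"
    by (simp only: cinner_self[symmetric] cinner_scaleC_left cinner_scaleC_right mult_ac)
  also have "\<dots> = complex_of_real ((cmod c * norm x)\<^sup>2)"
    by (simp add: complex_norm_square[symmetric] power_mult_distrib)
  finally have "(norm (c *\<^sub>C x))\<^sup>2 = (cmod c * norm x)\<^sup>2" by (simp only: of_real_eq_iff)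
  then show ?thesis by simp
qed

text \<open>A unimodular factor \<open>c\<close> rotates the complex product onto the nonnegative
  real axis, where the real Cauchy-Schwarz inequality applies.\<close>

lemma cmod_cinner_le: "cmod (cinner x y) \<le> norm x * norm y"
proof (cases "cinner x y = 0")
  case False
  define c where "c = cnj (cinner x y) / cmod (cinner x y)"
  have c: "cmod c = 1" using False by (simp add: c_def norm_divide)
  have "cinner (c *\<^sub>C x) y = of_real (cmod (cinner x y))"
    using False complex_norm_square[of "cinner x y"]
    by (simp add: cinner_scaleC_left c_def field_simps power2_eq_square)
  then have "cmod (cinner x y) = inner (c *\<^sub>C x) y" by (simp add: inner_eq_Re_cinner)
  also have "\<dots> \<le> norm (c *\<^sub>C x) * norm y" by (rule norm_cauchy_schwarz)
  finally show ?thesis using c by simp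
qed simp

lemma cinner_eqI:
  assumes "\<And>x. cinner x y = cinner x z"
  shows "y = z"
proof -
  have "inner (y - z) (y - z) = 0"
    using assms[of "y - z"] by (simp add: inner_eq_Re_cinner cinner_diff_right)
  then show ?thesis by simp
qed

section \<open>Bounded complex-linear operators\<close>

lemma bounded_clinear_imp_bounded_linear: "bounded_clinear T \<Longrightarrow> bounded_linear T"
  by (simp add: bounded_clinear_def)

lemma bounded_clinear_scaleC_commute: "bounded_clinear T \<Longrightarrow> T (c *\<^sub>C x) = c *\<^sub>C T x"
  by (simp add: bounded_clinear_def)

lemma bounded_clinear_add: "bounded_clinear T \<Longrightarrow> T (x + y) = T x + T y"
  by (simp add: bounded_clinear_imp_bounded_linear linear_simps)

lemma bounded_clinear_diff: "bounded_clinear T \<Longrightarrow> T (x - y) = T x - T y"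
  by (simp add: bounded_clinear_imp_bounded_linear linear_simps)

lemma bounded_clinear_uminus: "bounded_clinear T \<Longrightarrow> T (- x) = - T x"
  by (simp add: bounded_clinear_imp_bounded_linear linear_simps)

lemma bounded_clinear_zero: "bounded_clinear T \<Longrightarrow> T 0 = 0"
  by (simp add: bounded_clinear_imp_bounded_linear linear_simps)

lemma bounded_clinear_norm_le: "bounded_clinear T \<Longrightarrow> norm (T x) \<le> onorm T * norm x"
  by (simp add: bounded_clinear_imp_bounded_linear onorm)

lemma bounded_clinearI:
  assumes "\<And>x y. T (x + y) = T x + T y" and "\<And>c x. T (c *\<^sub>C x) = c *\<^sub>C T x"
    and "\<And>x. norm (T x) \<le> K * norm x"
  shows "bounded_clinear T"
  unfolding bounded_clinear_def
  using assms by (auto intro!: bounded_linear_intro[where K = K] simp: scaleR_scaleC mult.commute)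

lemma bounded_clinear_id: "bounded_clinear (\<lambda>x. x)"
  by (simp add: bounded_clinear_def bounded_linear_ident)

lemma bounded_clinear_scaleC:
  assumes "bounded_clinear T"
  shows "bounded_clinear (\<lambda>x. c *\<^sub>C T x)"
proof (rule bounded_clinearI[where K = "cmod c * onorm T"])
  show "norm (c *\<^sub>C T x) \<le> cmod c * onorm T * norm x" for x
    using bounded_clinear_norm_le[OF assms, of x] by (simp add: mult.assoc mult_left_mono)
qed (simp_all add: bounded_clinear_add[OF assms] bounded_clinear_scaleC_commute[OF assms]
      scaleC_add_right scaleC_scaleC mult.commute)

lemma bounded_clinear_scaleR:
  "bounded_clinear T \<Longrightarrow> bounded_clinear (\<lambda>x. s *\<^sub>R T x)"
  by (simp add: scaleR_scaleC bounded_clinear_scaleC)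

lemma bounded_clinear_compose:
  "bounded_clinear S \<Longrightarrow> bounded_clinear T \<Longrightarrow> bounded_clinear (\<lambda>x. S (T x))"
  by (simp add: bounded_clinear_def bounded_linear_compose)

lemma bounded_clinear_plus:
  "bounded_clinear S \<Longrightarrow> bounded_clinear T \<Longrightarrow> bounded_clinear (\<lambda>x. S x + T x)"
  by (simp add: bounded_clinear_def bounded_linear_add scaleC_add_right)

lemma bounded_clinear_minus:
  "bounded_clinear S \<Longrightarrow> bounded_clinear T \<Longrightarrow> bounded_clinear (\<lambda>x. S x - T x)"
  by (simp add: bounded_clinear_def bounded_linear_sub scaleC_diff_right)

lemma onorm_le_iff:
  assumes "bounded_clinear T" "0 \<le> b"
  shows "onorm T \<le> b \<longleftrightarrow> (\<forall>x. norm (T x) \<le> b * norm x)"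
  using bounded_clinear_norm_le[OF assms(1)] onorm_bound[OF assms(2)]
  by (meson mult_right_mono norm_ge_zero order_trans)

section \<open>Invertible operators\<close>

text \<open>The lower bound gives injectivity; evaluated at \<open>inv T x\<close>, it bounds the
  inverse by \<open>inverse c\<close>.\<close>

lemma invertible_opI:
  assumes "bounded_clinear T" and "0 < c" and below: "\<And>x. c * norm x \<le> norm (T x)" and "surj T"
  shows "invertible_op T"
proof -
  have inj: "inj T"
  proof (rule injI)
    fix x y assume "T x = T y"
    then have "c * norm (x - y) \<le> 0"
      using below[of "x - y"] by (simp add: bounded_clinear_diff[OF assms(1)])
    then show "x = y"
      using \<open>0 < c\<close> by (simp add: mult_le_0_iff)
  qed
  have T_inv: "T (inv T x) = x" for x
    using \<open>surj T\<close> by (rule surj_f_inv_f)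
  have "bounded_clinear (inv T)"
  proof (rule bounded_clinearI)
    show "inv T (x + y) = inv T x + inv T y" for x y
      by (metis T_inv inj inv_f_f bounded_clinear_add[OF assms(1)])
    show "inv T (d *\<^sub>C x) = d *\<^sub>C inv T x" for d x
      by (metis T_inv inj inv_f_f bounded_clinear_scaleC_commute[OF assms(1)])
    show "norm (inv T x) \<le> inverse c * norm x" for x
      using below[of "inv T x"] \<open>0 < c\<close> by (simp add: T_inv field_simps)
  qed
  moreover have "inv T \<circ> T = id" "T \<circ> inv T = id"
    using inj by (auto simp: T_inv)
  ultimately show ?thesis
    unfolding invertible_op_def using assms(1) by blast
qed

lemma invertible_opD:
  assumes "invertible_op T"
  shows "bounded_clinear T" "bounded_clinear (inv T)" "inv T (T x) = x" "T (inv T x) = x"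
proof -
  obtain S where S: "bounded_clinear S" "S \<circ> T = id" "T \<circ> S = id"
    using assms by (auto simp: invertible_op_def)
  then have "inv T = S" by (intro inv_unique_comp)
  with S assms show "bounded_clinear T" "bounded_clinear (inv T)" "inv T (T x) = x" "T (inv T x) = x"
    by (simp_all add: invertible_op_def pointfree_idE)
qed

lemma invertible_op_inverse:
  assumes "bounded_clinear T" "bounded_clinear S" "\<And>x. S (T x) = x" "\<And>x. T (S x) = x"
  shows "invertible_op T" "inv T = S"
proof -
  have "S \<circ> T = id" "T \<circ> S = id"
    using assms by (simp_all add: fun_eq_iff)
  then show "invertible_op T" "inv T = S"
    using assms(1,2) by (auto simp: invertible_op_def intro!: inv_unique_comp)
qed

lemma invertible_op_compose:
  assumes "invertible_op S" "invertible_op T"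
  shows "invertible_op (\<lambda>x. S (T x))"
proof (rule invertible_op_inverse(1)[where S = "\<lambda>x. inv T (inv S x)"])
  note S = invertible_opD[OF assms(1)] and T = invertible_opD[OF assms(2)]
  show "bounded_clinear (\<lambda>x. S (T x))" "bounded_clinear (\<lambda>x. inv T (inv S x))"
    by (rule bounded_clinear_compose; rule S T)+
qed (simp_all add: invertible_opD(3,4)[OF assms(1)] invertible_opD(3,4)[OF assms(2)])

lemma invertible_op_scaleC:
  assumes "c \<noteq> 0" "invertible_op T"
  shows "invertible_op (\<lambda>x. c *\<^sub>C T x)"
proof (rule invertible_op_inverse(1)[where S = "\<lambda>x. inverse c *\<^sub>C inv T x"])
  note T = invertible_opD[OF assms(2)]
  show "bounded_clinear (\<lambda>x. c *\<^sub>C T x)" "bounded_clinear (\<lambda>x. inverse c *\<^sub>C inv T x)"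
    by (intro bounded_clinear_scaleC T)+
  show "inverse c *\<^sub>C inv T (c *\<^sub>C T x) = x" "c *\<^sub>C T (inverse c *\<^sub>C inv T x) = x" for x
    using \<open>c \<noteq> 0\<close>
    by (simp_all add: T(3,4) bounded_clinear_scaleC_commute[OF T(1)]
        bounded_clinear_scaleC_commute[OF T(2)] scaleC_scaleC)
qed

lemma invertible_op_bounded_below:
  assumes "invertible_op T"
  shows "norm x \<le> onorm (inv T) * norm (T x)"
  using bounded_clinear_norm_le[OF invertible_opD(2)[OF assms], of "T x"]
  by (simp add: invertible_opD(3)[OF assms])

section \<open>Adjoints\<close>

text \<open>The hypothesis at \<open>x\<close> gives the real parts and at
  \<open>- (\<i> *\<^sub>C x)\<close> the imaginary parts, because \<open>T\<close> commutes with
  multiplication by \<open>\<i>\<close>.\<close>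

lemma cinner_eq_if_inner_eq:
  assumes T: "bounded_clinear T" and S: "\<And>x y. inner (T x) y = inner x (S y)"
  shows "cinner (T x) y = cinner x (S y)"
  by (simp add: cinner_eq_inner S[symmetric] bounded_clinear_uminus[OF T]
      bounded_clinear_scaleC_commute[OF T] del: inner_minus_left)

text \<open>The solution minimises the energy \<open>\<langle>B x, x\<rangle> - 2 f x\<close>: by the parallelogram law for the
  form of \<open>B\<close>, every minimising sequence is Cauchy.\<close>

lemma coercive_representation:
  fixes B :: "'a::{real_inner, banach} \<Rightarrow> 'a" and f :: "'a \<Rightarrow> real"
  assumes B: "bounded_linear B" and sym: "\<And>x y. inner (B x) y = inner x (B y)"
    and c: "0 < c" "\<And>x. c * (norm x)\<^sup>2 \<le> inner (B x) x" and f: "bounded_linear f"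
  obtains u where "\<And>v. inner (B u) v = f v"
proof -
  define J where "J x = inner (B x) x - 2 * f x" for x
  define K where "K = onorm f"
  have fK: "\<bar>f x\<bar> \<le> K * norm x" for x
    using onorm[OF f, of x] by (simp add: K_def)
  note lin = linear_simps[OF B] linear_simps[OF f]
  have lower: "- (K\<^sup>2 / c) \<le> J x" for x
  proof -
    \<comment> \<open>Completing the square shows that the energy is bounded below, so its infimum
      is finite.\<close>
    have "0 \<le> (c * norm x - K)\<^sup>2" by simp
    then have "c * (2 * (K * norm x)) \<le> c * (c * (norm x)\<^sup>2) + K\<^sup>2"
      by (simp add: power2_eq_square algebra_simps)
    then have "2 * (K * norm x) \<le> c * (norm x)\<^sup>2 + K\<^sup>2 / c"
      using c(1) by (simp add: field_simps)
    then show ?thesis using fK[of x] c(2)[of x] by (simp add: J_def)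
  qed
  have bdd: "bdd_below (range J)" using lower by (auto simp: bdd_below_def)
  define m where "m = Inf (range J)"
  have m: "m \<le> J x" for x unfolding m_def using bdd by (auto intro: cInf_lower)
  have "\<exists>x. J x < m + 1 / real (Suc n)" for n
    using cInf_lessD[of "range J" "m + 1 / real (Suc n)"] by (force simp: m_def)
  then obtain X where X: "\<And>n. J (X n) < m + 1 / real (Suc n)" by metis
  have par: "c * (norm (x - y))\<^sup>2 \<le> 2 * J x + 2 * J y - 4 * m" for x y
  proof -
    have "inner (B (x - y)) (x - y) = 2 * J x + 2 * J y - 4 * J ((1/2) *\<^sub>R (x + y))"
      by (simp add: J_def lin inner_simps algebra_simps)
    then show ?thesis using c(2)[of "x - y"] m[of "(1/2) *\<^sub>R (x + y)"] by linarith
  qed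
  have "Cauchy X"
  proof (rule CauchyI)
    fix e :: real assume e: "0 < e"
    obtain N where N: "4 / real (Suc N) < c * e\<^sup>2"
      using reals_Archimedean[of "c * e\<^sup>2 / 4"] c(1) e by (auto simp: field_simps)
    have "norm (X i - X j) < e" if "N \<le> i" "N \<le> j" for i j
    proof -
      have "1 / real (Suc i) \<le> 1 / real (Suc N)" "1 / real (Suc j) \<le> 1 / real (Suc N)"
        using that by (simp_all add: field_simps)
      then have "c * (norm (X i - X j))\<^sup>2 < c * e\<^sup>2"
        using par[of "X i" "X j"] X[of i] X[of j] N by linarith
      then show ?thesis using c(1) e by (simp add: power2_less_imp_less)
    qed
    then show "\<exists>M. \<forall>m\<ge>M. \<forall>n\<ge>M. norm (X m - X n) < e" by blast
  qed
  then obtain u where u: "X \<longlonglongrightarrow> u" by (auto simp: Cauchy_convergent_iff convergent_def)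
  have "(\<lambda>n. J (X n)) \<longlonglongrightarrow> J u"
    unfolding J_def by (intro tendsto_intros bounded_linear.tendsto[OF B] bounded_linear.tendsto[OF f] u)
  moreover have "(\<lambda>n. m + 1 / real (Suc n)) \<longlonglongrightarrow> m + 0"
    by (intro tendsto_intros LIMSEQ_Suc lim_1_over_n)
  ultimately have "J u \<le> m + 0"
    by (rule LIMSEQ_le) (use X in \<open>auto intro: less_imp_le\<close>)
  then have Ju: "J u \<le> J x" for x using m[of x] by simp
  have "inner (B u) v = f v" for v
  proof -
    define d where "d = inner (B u) v - f v"
    define k where "k = inner (B v) v"
    have quad: "0 \<le> 2 * t * d + t\<^sup>2 * k" for t
    proof -
      have "inner (B v) u = inner (B u) v" by (metis sym inner_commute)
      then have "J (u + t *\<^sub>R v) = J u + 2 * t * d + t\<^sup>2 * k"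
        by (simp add: J_def d_def k_def lin inner_simps algebra_simps power2_eq_square)
      then show ?thesis using Ju[of "u + t *\<^sub>R v"] by simp
    qed
    have k: "0 \<le> k" unfolding k_def using c(2)[of v] c(1)
      by (meson less_imp_le mult_nonneg_nonneg order_trans zero_le_power2)
    \<comment> \<open>At \<open>t = - s\<close> the inequality \<open>quad\<close> reads
      \<open>0 \<le> - s^2 (k + 2)\<close>, which forces \<open>s = 0\<close>. Dividing by
      \<open>k + 1\<close> rather than \<open>k\<close> also covers \<open>k = 0\<close>.\<close>
    define s where "s = d / (k + 1)"
    have d: "d = s * (k + 1)" using k by (simp add: s_def)
    have "s\<^sup>2 * (k + 2) \<le> 0"
      using quad[of "- s"] by (simp add: d algebra_simps power2_eq_square)
    then have "d = 0" using k by (simp add: d mult_le_0_iff)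
    then show ?thesis by (simp add: d_def)
  qed
  then show ?thesis by (rule that)
qed

text \<open>Riesz representation, obtained from \<open>coercive_representation\<close> with the
  identity as \<open>B\<close> and \<open>c = 1\<close>. Uniqueness by \<open>cinner_eqI\<close>
  makes the definite description in \<open>cadjoint\<close> refer to this solution.\<close>

lemma cadjoint:
  fixes T :: "'a::chilbert_space \<Rightarrow> 'a"
  assumes T: "bounded_clinear T"
  shows "cinner (T x) y = cinner x (cadjoint T y)"
proof -
  have "\<exists>u. \<forall>v. inner u v = inner (T v) y" for y
  proof -
    have "bounded_linear (\<lambda>v. inner (T v) y)"
      by (intro bounded_linear_compose[OF bounded_linear_inner_left]
          bounded_clinear_imp_bounded_linear T)
    from coercive_representation[OF bounded_linear_ident _ zero_less_one _ this]
    show ?thesis by (metis order_refl mult_1 power2_norm_eq_inner)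
  qed
  then obtain S where "\<And>x y. inner (T x) y = inner x (S y)"
    by (metis inner_commute)
  then have S: "\<forall>x y. cinner (T x) y = cinner x (S y)"
    using cinner_eq_if_inner_eq[OF T] by blast
  have "\<forall>x y. cinner (T x) y = cinner x (cadjoint T y)"
    unfolding cadjoint_def
  proof (rule theI[of "\<lambda>S. \<forall>x y. cinner (T x) y = cinner x (S y)", OF S])
    show "S' = S" if "\<forall>x y. cinner (T x) y = cinner x (S' y)" for S'
      using that S by (metis cinner_eqI ext)
  qed
  then show ?thesis by blast
qed

lemma cadjoint_unique:
  fixes T :: "'a::chilbert_space \<Rightarrow> 'a"
  assumes "bounded_clinear T" "\<And>x y. cinner (T x) y = cinner x (S y)"
  shows "cadjoint T = S"
  by (rule ext, rule cinner_eqI) (simp only: cadjoint[OF assms(1), symmetric] assms(2))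

lemma cadjoint_left:
  fixes T :: "'a::chilbert_space \<Rightarrow> 'a"
  assumes "bounded_clinear T"
  shows "cinner (cadjoint T x) y = cinner x (T y)"
proof -
  have "cinner (cadjoint T x) y = cnj (cinner y (cadjoint T x))" by (rule cinner_commute)
  also have "\<dots> = cnj (cinner (T y) x)" by (simp only: cadjoint[OF assms])
  also have "\<dots> = cinner x (T y)" by (rule cinner_commute[symmetric])
  finally show ?thesis .
qed

lemma inner_cadjoint:
  fixes T :: "'a::chilbert_space \<Rightarrow> 'a"
  assumes "bounded_clinear T"
  shows "inner (T x) y = inner x (cadjoint T y)" "inner (cadjoint T x) y = inner x (T y)"
  by (simp_all add: inner_eq_Re_cinner cadjoint[OF assms] cadjoint_left[OF assms])

text \<open>The squared norm of \<open>cadjoint T x\<close> is the product of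
  \<open>T (cadjoint T x)\<close> with \<open>x\<close>; one factor
  \<open>norm (cadjoint T x)\<close> then cancels.\<close>

lemma norm_cadjoint_le:
  fixes T :: "'a::chilbert_space \<Rightarrow> 'a"
  assumes T: "bounded_clinear T"
  shows "norm (cadjoint T x) \<le> onorm T * norm x"
proof (cases "cadjoint T x = 0")
  case True
  then show ?thesis
    using onorm_pos_le[OF bounded_clinear_imp_bounded_linear[OF T]] by simp
next
  case False
  have "norm (cadjoint T x) * norm (cadjoint T x) = inner (T (cadjoint T x)) x"
    by (simp add: inner_cadjoint[OF T] power2_norm_eq_inner[symmetric] power2_eq_square)
  also have "\<dots> \<le> norm (T (cadjoint T x)) * norm x" by (rule norm_cauchy_schwarz)
  also have "\<dots> \<le> (onorm T * norm (cadjoint T x)) * norm x"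
    by (intro mult_right_mono bounded_clinear_norm_le T) simp
  finally have "norm (cadjoint T x) * norm (cadjoint T x)
      \<le> norm (cadjoint T x) * (onorm T * norm x)" by (simp add: mult_ac)
  with False show ?thesis by simp
qed

lemma bounded_clinear_cadjoint:
  fixes T :: "'a::chilbert_space \<Rightarrow> 'a"
  assumes T: "bounded_clinear T"
  shows "bounded_clinear (cadjoint T)"
proof (rule bounded_clinearI)
  show "cadjoint T (x + y) = cadjoint T x + cadjoint T y" for x y
    by (rule cinner_eqI) (simp add: cadjoint[OF T, symmetric] cinner_add_right)
  show "cadjoint T (c *\<^sub>C x) = c *\<^sub>C cadjoint T x" for c x
    by (rule cinner_eqI) (simp add: cadjoint[OF T, symmetric] cinner_scaleC_right)
qed (rule norm_cadjoint_le[OF T])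

lemma cadjoint_cadjoint:
  fixes T :: "'a::chilbert_space \<Rightarrow> 'a"
  assumes "bounded_clinear T"
  shows "cadjoint (cadjoint T) = T"
  using assms by (intro cadjoint_unique bounded_clinear_cadjoint) (simp_all add: cadjoint_left)

lemma onorm_cadjoint:
  fixes T :: "'a::chilbert_space \<Rightarrow> 'a"
  assumes T: "bounded_clinear T"
  shows "onorm (cadjoint T) = onorm T"
proof (rule antisym)
  have "onorm (cadjoint S) \<le> onorm S" if "bounded_clinear S" for S :: "'a \<Rightarrow> 'a"
    using onorm_pos_le[OF bounded_clinear_imp_bounded_linear[OF that]] norm_cadjoint_le[OF that]
    by (rule onorm_bound)
  from this[OF T] this[OF bounded_clinear_cadjoint[OF T]]
  show "onorm (cadjoint T) \<le> onorm T" "onorm T \<le> onorm (cadjoint T)"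
    by (simp_all add: cadjoint_cadjoint[OF T])
qed

lemma invertible_op_cadjoint:
  fixes T :: "'a::chilbert_space \<Rightarrow> 'a"
  assumes T: "invertible_op T"
  shows "invertible_op (cadjoint T)" "inv (cadjoint T) = cadjoint (inv T)"
proof -
  note T' = invertible_opD[OF T]
  have 1: "cadjoint (inv T) (cadjoint T x) = x" for x
    by (rule cinner_eqI) (simp only: cadjoint[OF T'(1), symmetric] cadjoint[OF T'(2), symmetric] T')
  have 2: "cadjoint T (cadjoint (inv T) x) = x" for x
    by (rule cinner_eqI) (simp only: cadjoint[OF T'(1), symmetric] cadjoint[OF T'(2), symmetric] T')
  note adj = invertible_op_inverse[OF T'(1,2)[THEN bounded_clinear_cadjoint] 1 2]
  show "invertible_op (cadjoint T)" "inv (cadjoint T) = cadjoint (inv T)"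
    by (rule adj)+
qed

section \<open>Polynomials in an operator\<close>

lemma poly_op_0 [simp]: "poly_op 0 T x = 0"
  by (simp add: poly_op_def)

text \<open>This Horner recursion turns the algebra of \<open>poly_op\<close> into inductions over
  \<open>pCons\<close>.\<close>

lemma poly_op_pCons:
  assumes T: "bounded_clinear T"
  shows "poly_op (pCons c p) T x = c *\<^sub>C x + T (poly_op p T x)"
proof (cases "p = 0")
  case True
  then show ?thesis by (simp add: poly_op_def bounded_clinear_zero[OF T])
next
  case False
  have "T (\<Sum>i\<in>A. coeff p i *\<^sub>C (T ^^ i) x) = (\<Sum>i\<in>A. coeff p i *\<^sub>C (T ^^ Suc i) x)" for A
    using bounded_clinear_imp_bounded_linear[OF T]
    by (simp add: linear_sum bounded_linear.linear bounded_clinear_scaleC_commute[OF T])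
  with False show ?thesis
    by (simp add: poly_op_def sum.atMost_Suc_shift del: sum.atMost_Suc)
qed

lemma poly_op_const: "poly_op [:c:] T x = c *\<^sub>C x"
  by (simp add: poly_op_def)

lemma poly_op_1 [simp]: "poly_op 1 T x = x"
  using poly_op_const[of 1] by (simp add: one_pCons)

lemma poly_op_linear: "bounded_clinear T \<Longrightarrow> poly_op [:c, d:] T x = c *\<^sub>C x + d *\<^sub>C T x"
  by (simp add: poly_op_pCons bounded_clinear_scaleC_commute bounded_clinear_zero)

lemma bounded_clinear_poly_op:
  assumes T: "bounded_clinear T"
  shows "bounded_clinear (poly_op p T)"
proof (induction p)
  case 0
  have "bounded_clinear (\<lambda>x. 0)" by (rule bounded_clinearI[where K = 0]) auto
  moreover have "poly_op 0 T = (\<lambda>x. 0)" by (rule ext) simp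
  ultimately show ?case by simp
next
  case (pCons c p)
  have "bounded_clinear (\<lambda>x. c *\<^sub>C x + T (poly_op p T x))"
    by (rule bounded_clinear_plus[OF bounded_clinear_scaleC[OF bounded_clinear_id]
        bounded_clinear_compose[OF T pCons.IH]])
  moreover have "poly_op (pCons c p) T = (\<lambda>x. c *\<^sub>C x + T (poly_op p T x))"
    by (rule ext) (rule poly_op_pCons[OF T])
  ultimately show ?case by simp
qed

lemma poly_op_add:
  assumes T: "bounded_clinear T"
  shows "poly_op (p + q) T x = poly_op p T x + poly_op q T x"
proof (induction p arbitrary: q)
  case (pCons c p)
  show ?case
    by (cases q) (simp add: poly_op_pCons[OF T] pCons.IH bounded_clinear_add[OF T] scaleC_add_left)
qed simp

lemma poly_op_smult:
  assumes T: "bounded_clinear T"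
  shows "poly_op (smult c p) T x = c *\<^sub>C poly_op p T x"
  by (induction p)
    (simp_all add: poly_op_pCons[OF T] bounded_clinear_scaleC_commute[OF T] scaleC_add_right
      scaleC_scaleC)

lemma poly_op_diff:
  assumes T: "bounded_clinear T"
  shows "poly_op (p - q) T x = poly_op p T x - poly_op q T x"
proof -
  have "p - q = p + smult (-1) q" by simp
  then show ?thesis by (simp only: poly_op_add[OF T] poly_op_smult[OF T] scaleC_minus_left) simp
qed

lemma poly_op_mult:
  assumes T: "bounded_clinear T"
  shows "poly_op (p * q) T x = poly_op p T (poly_op q T x)"
  by (induction p)
    (simp_all add: poly_op_pCons[OF T] poly_op_add[OF T] poly_op_smult[OF T])

lemma poly_op_commute:
  assumes "bounded_clinear T" "bounded_clinear S" "\<And>x. S (T x) = T (S x)"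
  shows "S (poly_op p T x) = poly_op p T (S x)"
  by (induction p)
    (simp_all add: poly_op_pCons[OF assms(1)] bounded_clinear_add[OF assms(2)]
      bounded_clinear_scaleC_commute[OF assms(2)] bounded_clinear_zero[OF assms(2)] assms(3))

lemma cinner_poly_op:
  assumes T: "bounded_clinear T" and sym: "\<And>x y. cinner (T x) y = cinner x (T y)"
  shows "cinner (poly_op p T x) y = cinner x (poly_op (map_poly cnj p) T y)"
proof (induction p arbitrary: x y)
  case (pCons c p)
  show ?case
    by (simp add: map_poly_pCons poly_op_pCons[OF T] cinner_add_left cinner_add_right
        cinner_scaleC_left cinner_scaleC_right sym pCons.IH poly_op_commute[OF T T])
qed simp

text \<open>Over the complex numbers \<open>q\<close> splits into linear factors. Each root
  \<open>z\<close> lies outside the spectrum, so each factor gives an invertible operator; induction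
  on the degree composes them.\<close>

lemma invertible_op_poly_op:
  assumes T: "bounded_clinear T" and "q \<noteq> 0" and "\<And>z. z \<in> spectrum T \<Longrightarrow> poly q z \<noteq> 0"
  shows "invertible_op (poly_op q T)"
  using assms(2,3)
proof (induction "degree q" arbitrary: q)
  case 0
  then obtain c where "q = [:c:]" "c \<noteq> 0" by (metis degree_eq_zeroE pCons_0_0)
  moreover have "poly_op [:c:] T = (\<lambda>x. c *\<^sub>C x)" by (rule ext) (rule poly_op_const)
  moreover have "invertible_op (\<lambda>x. x)"
    by (rule invertible_op_inverse(1)[of _ "\<lambda>x. x"]) (auto simp: bounded_clinear_id)
  ultimately show ?case using invertible_op_scaleC[of c "\<lambda>x. x"] by simp
next
  case (Suc n)
  then have "\<not> constant (poly q)" by (simp add: constant_degree)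
  then obtain z where "poly q z = 0" using fundamental_theorem_of_algebra by blast
  then obtain s where q: "q = [:- z, 1:] * s" by (metis dvdE poly_eq_0_iff_dvd)
  have "s \<noteq> 0" using Suc.prems(1) q by auto
  then have "degree q = Suc (degree s)" unfolding q by (subst degree_mult_eq) auto
  then have s: "invertible_op (poly_op s T)"
    using Suc \<open>s \<noteq> 0\<close> by (auto simp: q)
  have "z \<notin> spectrum T" using Suc.prems(2) \<open>poly q z = 0\<close> by blast
  then have "invertible_op (\<lambda>x. z *\<^sub>C x - T x)" by (simp add: spectrum_def)
  \<comment> \<open>The sign turns \<open>z - T\<close>, as it occurs in \<open>spectrum\<close>,
    into the factor \<open>T - z\<close> that belongs to \<open>[:- z, 1:]\<close>.\<close>
  then have "invertible_op (\<lambda>x. (-1) *\<^sub>C (z *\<^sub>C x - T x))" by (intro invertible_op_scaleC) simp_all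
  from invertible_op_compose[OF this s]
  have "invertible_op (\<lambda>x. (-1) *\<^sub>C (z *\<^sub>C poly_op s T x - T (poly_op s T x)))" .
  also have "(\<lambda>x. (-1) *\<^sub>C (z *\<^sub>C poly_op s T x - T (poly_op s T x))) = poly_op q T"
    unfolding q poly_op_mult[OF T]
    by (rule ext) (simp add: poly_op_mult[OF T] poly_op_linear[OF T] scaleC_minus_left)
  finally show ?case .
qed

section \<open>Self-adjoint operators\<close>

text \<open>The operator inequality a <= P <= b for self-adjoint \<open>P\<close>: the numerical
  range lies in the real interval from \<open>a\<close> to \<open>b\<close>.\<close>

definition selfadjoint_between :: "real \<Rightarrow> real \<Rightarrow> ('a::complex_inner \<Rightarrow> 'a) \<Rightarrow> bool"
  where "selfadjoint_between a b P \<longleftrightarrow> bounded_clinear P \<and>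
    (\<forall>x y. cinner (P x) y = cinner x (P y)) \<and>
    (\<forall>x. a * (norm x)\<^sup>2 \<le> inner (P x) x \<and> inner (P x) x \<le> b * (norm x)\<^sup>2)"

lemma selfadjoint_betweenD:
  assumes "selfadjoint_between a b P"
  shows "bounded_clinear P" "cinner (P x) y = cinner x (P y)"
    "a * (norm x)\<^sup>2 \<le> inner (P x) x" "inner (P x) x \<le> b * (norm x)\<^sup>2"
  using assms by (auto simp: selfadjoint_between_def)

text \<open>The Rayleigh quotient \<open>w\<close> of \<open>x\<close> lies in
  \<open>{a..b}\<close>, so the form of \<open>z - P\<close> at \<open>x\<close> has modulus |z - w|
  times the squared norm. The distance from \<open>z\<close> to the interval bounds this below, and
  Cauchy-Schwarz bounds it above by the norm of \<open>z *\<^sub>C x - P x\<close> times that of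
  \<open>x\<close>.\<close>

lemma selfadjoint_bounded_below:
  assumes P: "selfadjoint_between a b P" and z: "z \<notin> complex_of_real ` {a..b}"
  obtains c where "0 < c" "\<And>x. c * norm x \<le> norm (z *\<^sub>C x - P x)"
proof -
  have "closed (complex_of_real ` {a..b})"
    by (intro compact_imp_closed compact_continuous_image continuous_intros) simp
  then obtain c where c: "0 < c" "\<And>w. w \<in> {a..b} \<Longrightarrow> c \<le> dist z (complex_of_real w)"
    using separate_point_closed[OF _ z] by blast
  have "c * norm x \<le> norm (z *\<^sub>C x - P x)" for x
  proof (cases "x = 0")
    case False
    define w where "w = inner (P x) x / (norm x)\<^sup>2"
    have "w \<in> {a..b}"
      using selfadjoint_betweenD(3,4)[OF P, of x] False by (simp add: w_def field_simps)
    have "Im (cinner (P x) x) = 0"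
      using cinner_commute[of "P x" x] selfadjoint_betweenD(2)[OF P, of x x]
      by (simp add: complex_eq_iff)
    then have "cinner (P x) x = complex_of_real (w * (norm x)\<^sup>2)"
      using False by (simp add: complex_eq_iff w_def inner_eq_Re_cinner)
    then have "cinner (z *\<^sub>C x - P x) x = (z - complex_of_real w) * complex_of_real ((norm x)\<^sup>2)"
      by (simp add: cinner_diff_left cinner_scaleC_left cinner_self algebra_simps)
    then have "cmod (cinner (z *\<^sub>C x - P x) x) = dist z (complex_of_real w) * (norm x)\<^sup>2"
      by (simp add: norm_mult dist_norm norm_power)
    then have "c * (norm x)\<^sup>2 \<le> norm (z *\<^sub>C x - P x) * norm x"
      using cmod_cinner_le[of "z *\<^sub>C x - P x" x] mult_right_mono[OF c(2)[OF \<open>w \<in> {a..b}\<close>], of "(norm x)\<^sup>2"]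
      by simp
    then show ?thesis using False by (simp add: power2_eq_square mult.assoc[symmetric])
  qed simp
  with c(1) show ?thesis by (rule that)
qed

text \<open>Away from the interval, \<open>N = z - P\<close> is bounded below, which leaves
  surjectivity. Its adjoint \<open>N'\<close> is bounded below as well, so \<open>N N'\<close> is
  symmetric and coercive, and \<open>coercive_representation\<close> solves
  \<open>N (N' u) = y\<close>.\<close>

lemma spectrum_selfadjoint:
  fixes P :: "'a::chilbert_space \<Rightarrow> 'a"
  assumes P: "selfadjoint_between a b P"
  shows "spectrum P \<subseteq> complex_of_real ` {a..b}"
proof (rule subsetI, rule ccontr)
  fix z assume z: "z \<in> spectrum P" "z \<notin> complex_of_real ` {a..b}"
  then have "cnj z \<notin> complex_of_real ` {a..b}" by (metis complex_cnj_cnj complex_cnj_complex_of_real imageE imageI)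
  then obtain d where d: "0 < d" "\<And>x. d * norm x \<le> norm (cnj z *\<^sub>C x - P x)"
    using selfadjoint_bounded_below[OF P] by blast
  obtain c where c: "0 < c" "\<And>x. c * norm x \<le> norm (z *\<^sub>C x - P x)"
    using selfadjoint_bounded_below[OF P z(2)] by blast
  define N N' where "N x = z *\<^sub>C x - P x" and "N' x = cnj z *\<^sub>C x - P x" for x
  have bdd: "bounded_clinear N" "bounded_clinear N'"
    unfolding N_def N'_def
    by (intro bounded_clinear_minus bounded_clinear_scaleC[OF bounded_clinear_id]
        selfadjoint_betweenD(1)[OF P])+
  have adj: "inner (N x) y = inner x (N' y)" for x y
    by (simp add: N_def N'_def inner_eq_Re_cinner cinner_diff_left cinner_diff_right
        cinner_scaleC_left cinner_scaleC_right selfadjoint_betweenD(2)[OF P])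
  then have sym: "inner (N (N' x)) y = inner x (N (N' y))" for x y
    by (metis inner_commute)
  have "\<exists>x. N x = y" for y
  proof -
    have lin: "bounded_linear (\<lambda>x. N (N' x))" "bounded_linear (inner y)"
      using bdd by (simp_all add: bounded_clinear_imp_bounded_linear bounded_linear_compose
          bounded_linear_inner_right)
    have low: "d\<^sup>2 * (norm x)\<^sup>2 \<le> inner (N (N' x)) x" for x
      using d power_mono[OF d(2)[of x], of 2]
      by (simp add: adj power2_norm_eq_inner N'_def power_mult_distrib)
    have "0 < d\<^sup>2" using d(1) by simp
    from coercive_representation[OF lin(1) sym this low lin(2)]
    obtain u where "\<And>v. inner (N (N' u)) v = inner y v" by blast
    then have "N (N' u) = y" using vector_eq_rdot by blast
    then show ?thesis by blast
  qed
  then have "surj N" by (metis surj_def)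
  have "invertible_op N"
    by (rule invertible_opI[OF bdd(1) c(1) _ \<open>surj N\<close>]) (use c(2) in \<open>simp add: N_def\<close>)
  with z(1) show False by (simp add: spectrum_def N_def[abs_def])
qed

section \<open>Positivity and norm bounds for polynomials in a self-adjoint operator\<close>

text \<open>Positivity is tested at \<open>L x - B x\<close> with \<open>L = onorm B + 1\<close>;
  the summand 1 keeps \<open>L\<close> positive when \<open>B = 0\<close>. In particular, a vector
  at which the form vanishes lies in the kernel of \<open>B\<close>.\<close>

lemma positive_form_norm_le:
  assumes B: "bounded_clinear B" and sym: "\<And>x y. inner (B x) y = inner x (B y)"
    and pos: "\<And>x. 0 \<le> inner (B x) x"
  shows "(norm (B x))\<^sup>2 \<le> (onorm B + 1) * inner (B x) x"
proof -
  define L where "L = onorm B + 1"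
  have L: "0 < L" using onorm_pos_le[OF bounded_clinear_imp_bounded_linear[OF B]] by (simp add: L_def)
  have "inner (B (B x)) (B x) \<le> norm (B (B x)) * norm (B x)" by (rule norm_cauchy_schwarz)
  also have "\<dots> \<le> (onorm B * norm (B x)) * norm (B x)"
    by (intro mult_right_mono bounded_clinear_norm_le[OF B]) simp
  also have "\<dots> \<le> L * (norm (B x))\<^sup>2"
    by (simp add: L_def power2_eq_square algebra_simps)
  finally have BB: "inner (B (B x)) (B x) \<le> L * (norm (B x))\<^sup>2" .
  have "0 \<le> inner (B (L *\<^sub>R x - B x)) (L *\<^sub>R x - B x)" by (rule pos)
  also have "\<dots> = L\<^sup>2 * inner (B x) x - 2 * L * (norm (B x))\<^sup>2 + inner (B (B x)) (B x)"
    using bounded_clinear_imp_bounded_linear[OF B] sym[of "B x" x]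
    by (simp add: linear_simps inner_simps dot_square_norm algebra_simps power2_eq_square)
  finally have "L * (norm (B x))\<^sup>2 \<le> L * (L * inner (B x) x)"
    using BB by (simp add: power2_eq_square algebra_simps)
  then show ?thesis using L by (simp add: L_def)
qed

text \<open>If the form of \<open>H = h(P)\<close> had a negative infimum \<open>m\<close> on the unit sphere, then \<open>H - m\<close>
  would be positive and not bounded below; but it is a polynomial in \<open>P\<close> without zeros on the
  spectrum, hence invertible.\<close>

lemma poly_op_nonneg:
  fixes P :: "'a::chilbert_space \<Rightarrow> 'a"
  assumes P: "selfadjoint_between a b P"
    and h: "\<And>t. t \<in> {a..b} \<Longrightarrow> poly h (complex_of_real t) \<in> \<real>\<^sub>\<ge>\<^sub>0"
    and sym: "\<And>x y. inner (poly_op h P x) y = inner x (poly_op h P y)"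
  shows "0 \<le> inner (poly_op h P x) x"
proof (rule ccontr)
  note bP = selfadjoint_betweenD(1)[OF P]
  define H where "H = poly_op h P"
  have bH: "bounded_clinear H" unfolding H_def by (rule bounded_clinear_poly_op[OF bP])
  note linH = linear_simps[OF bounded_clinear_imp_bounded_linear[OF bH]]
  define R where "R = (\<lambda>x. inner (H x) x) ` {x. norm x = 1}"
  assume neg: "\<not> 0 \<le> inner (poly_op h P x) x"
  then have x: "x \<noteq> 0" by auto
  have scale: "inner (H y) y = (norm y)\<^sup>2 * inner (H (y /\<^sub>R norm y)) (y /\<^sub>R norm y)" if "y \<noteq> 0" for y
    using that by (simp add: linH power2_eq_square field_simps)
  have "bdd_below R"
  proof (rule bdd_belowI)
    fix s assume "s \<in> R"
    then obtain y where y: "norm y = 1" "s = inner (H y) y" by (auto simp: R_def)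
    have "\<bar>s\<bar> \<le> norm (H y) * norm y" unfolding y(2) by (rule Cauchy_Schwarz_ineq2)
    then show "- onorm H \<le> s" using bounded_clinear_norm_le[OF bH, of y] y(1) by simp
  qed
  define m where "m = Inf R"
  have m_le: "m \<le> inner (H y) y" if "norm y = 1" for y
    unfolding m_def using that \<open>bdd_below R\<close> by (auto simp: R_def intro!: cInf_lower)
  have "m < 0"
  proof -
    have "inner (H (x /\<^sub>R norm x)) (x /\<^sub>R norm x) < 0"
      using neg scale[OF x] x by (simp add: H_def[symmetric] not_le mult_less_0_iff)
    moreover have "m \<le> inner (H (x /\<^sub>R norm x)) (x /\<^sub>R norm x)" using x by (intro m_le) simp
    ultimately show ?thesis by simp
  qed
  \<comment> \<open>A nonzero vector forces \<open>a \<le> b\<close>; the value of \<open>g\<close>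
    at \<open>a\<close> then shows \<open>g \<noteq> 0\<close>.\<close>
  have "a * (norm x)\<^sup>2 \<le> b * (norm x)\<^sup>2" using selfadjoint_betweenD(3,4)[OF P, of x] by simp
  then have "a \<in> {a..b}" using x by simp
  define g where "g = h - [:complex_of_real m:]"
  have g: "poly g (complex_of_real t) \<noteq> 0" if "t \<in> {a..b}" for t
    using h[OF that] \<open>m < 0\<close> by (auto simp: g_def complex_nonneg_Reals_iff complex_eq_iff)
  define G where "G = poly_op g P"
  have G: "G y = H y - m *\<^sub>R y" for y
    by (simp add: G_def g_def H_def poly_op_diff[OF bP] poly_op_const scaleR_scaleC)
  have "g \<noteq> 0" using g[OF \<open>a \<in> {a..b}\<close>] by auto
  then have inv: "invertible_op G"
    unfolding G_def using g spectrum_selfadjoint[OF P] by (intro invertible_op_poly_op bP) auto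
  \<comment> \<open>The lower bound for the norm of \<open>G y\<close> coming from
    \<open>inv G\<close>, combined with \<open>positive_form_norm_le\<close>, yields 1 <= D <G y, y>
    on unit vectors.\<close>
  define D where "D = (onorm (inv G))\<^sup>2 * (onorm G + 1)"
  note bG = invertible_opD(1,2)[OF inv, THEN bounded_clinear_imp_bounded_linear]
  have "0 \<le> D"
    unfolding D_def using onorm_pos_le[OF bG(1)] by simp
  have low: "1 \<le> D * (inner (H y) y - m)" if "norm y = 1" for y
  proof -
    have psd: "0 \<le> inner (G v) v" for v
    proof (cases "v = 0")
      case False
      have "(norm v)\<^sup>2 * m \<le> (norm v)\<^sup>2 * inner (H (v /\<^sub>R norm v)) (v /\<^sub>R norm v)"
        using False by (intro mult_left_mono m_le) simp_all
      then show ?thesis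
        unfolding scale[OF False, symmetric]
        by (simp add: G inner_diff_left power2_norm_eq_inner mult.commute)
    qed simp
    have "norm y \<le> onorm (inv G) * norm (G y)" by (rule invertible_op_bounded_below[OF inv])
    then have "1 \<le> (onorm (inv G) * norm (G y))\<^sup>2" using that by (simp add: one_le_power)
    also have "\<dots> = (onorm (inv G))\<^sup>2 * (norm (G y))\<^sup>2" by (rule power_mult_distrib)
    also have "\<dots> \<le> (onorm (inv G))\<^sup>2 * ((onorm G + 1) * inner (G y) y)"
    proof (intro mult_left_mono positive_form_norm_le psd invertible_opD(1)[OF inv])
      show "inner (G u) v = inner u (G v)" for u v
        using sym by (simp add: G H_def inner_diff_left inner_diff_right)
    qed simp
    also have "\<dots> = D * (inner (H y) y - m)"
      using that by (simp add: D_def G inner_diff_left power2_norm_eq_inner[symmetric])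
    finally show ?thesis .
  qed
  have "x /\<^sub>R norm x \<in> {x. norm x = 1}" using x by simp
  then have "R \<noteq> {}" unfolding R_def by blast
  \<comment> \<open>A unit vector whose form is within \<open>1 / (D + 1)\<close> of the infimum
    would give \<open>1 \<le> D / (D + 1)\<close>, a contradiction.\<close>
  moreover have "m < m + 1 / (D + 1)" using \<open>0 \<le> D\<close> by simp
  ultimately obtain s where s: "s \<in> R" "s < m + 1 / (D + 1)"
    using cInf_lessD unfolding m_def by blast
  then obtain y where y: "norm y = 1" "inner (H y) y - m < 1 / (D + 1)"
    by (auto simp: R_def algebra_simps)
  have "1 \<le> D * (1 / (D + 1))"
    using low[OF y(1)] mult_left_mono[OF less_imp_le[OF y(2)] \<open>0 \<le> D\<close>] by linarith
  then show False using \<open>0 \<le> D\<close> by (simp add: field_simps)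
qed

text \<open>The form of \<open>h\<close> at \<open>x\<close> is the difference of the squares of the
  two sides. With \<open>q = 1\<close> the lemma bounds the norm of a polynomial in
  \<open>P\<close>; for general \<open>q\<close> it bounds rational functions.\<close>

lemma poly_op_norm_le:
  fixes P :: "'a::chilbert_space \<Rightarrow> 'a"
  assumes P: "selfadjoint_between a b P" and "0 \<le> M"
    and pq: "\<And>t. t \<in> {a..b} \<Longrightarrow> cmod (poly p (complex_of_real t)) \<le> M * cmod (poly q (complex_of_real t))"
  shows "norm (poly_op p P x) \<le> M * norm (poly_op q P x)"
proof -
  note bP = selfadjoint_betweenD(1)[OF P]
  define h where "h = smult (complex_of_real (M\<^sup>2)) (map_poly cnj q * q) - map_poly cnj p * p"
  \<comment> \<open>On the real axis, conjugating the coefficients conjugates the value. Hence |p|^2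
    and |q|^2 agree there with polynomials, which can be applied to \<open>P\<close>.\<close>
  have cnj: "poly (map_poly cnj f) (complex_of_real t) = cnj (poly f (complex_of_real t))" for f t
    using poly_cnj[of f "complex_of_real t"] by simp
  have h_eq: "poly h (complex_of_real t)
      = complex_of_real ((M * cmod (poly q (complex_of_real t)))\<^sup>2 - (cmod (poly p (complex_of_real t)))\<^sup>2)" for t
    by (simp only: h_def poly_diff poly_smult poly_mult cnj of_real_diff of_real_mult
        power_mult_distrib complex_norm_square mult.commute[of "cnj (poly _ _)"])
  have h: "poly h (complex_of_real t) \<in> \<real>\<^sub>\<ge>\<^sub>0" if "t \<in> {a..b}" for t
    using power_mono[OF pq[OF that], of 2] by (simp only: h_eq nonneg_Reals_of_real_iff diff_ge_0_iff_ge) simp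
  have adj: "inner (poly_op (map_poly cnj f) P x) y = inner x (poly_op f P y)" for f x y
    unfolding inner_commute[of _ y] inner_commute[of x]
    by (simp add: inner_eq_Re_cinner cinner_poly_op[OF bP selfadjoint_betweenD(2)[OF P]])
  have H: "inner (poly_op h P x) y
      = M\<^sup>2 * inner (poly_op q P x) (poly_op q P y) - inner (poly_op p P x) (poly_op p P y)" for x y
    by (simp add: h_def poly_op_diff[OF bP] poly_op_smult[OF bP] poly_op_mult[OF bP]
        scaleR_scaleC[symmetric] inner_diff_left adj del: of_real_power)
  have sym: "inner (poly_op h P x) y = inner x (poly_op h P y)" for x y
    unfolding inner_commute[of x "poly_op h P y"] H by (simp add: inner_commute)
  have "0 \<le> inner (poly_op h P x) x" by (rule poly_op_nonneg[OF P h sym])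
  then have "(norm (poly_op p P x))\<^sup>2 \<le> (M * norm (poly_op q P x))\<^sup>2"
    by (simp only: H dot_square_norm power_mult_distrib diff_ge_0_iff_ge)
  then show ?thesis by (rule power2_le_imp_le) (simp add: \<open>0 \<le> M\<close>)
qed

section \<open>Positive operators and square roots\<close>

lemma positive_opI:
  assumes "bounded_clinear A" "\<And>x y. inner (A x) y = inner x (A y)" "\<And>x. 0 \<le> inner (A x) x"
  shows "positive_op A"
proof -
  have "cinner (A x) x \<in> \<real>\<^sub>\<ge>\<^sub>0" for x
    using cinner_eq_if_inner_eq[OF assms(1,2), of x x] cinner_commute[of "A x" x] assms(3)[of x]
    by (simp add: complex_nonneg_Reals_iff complex_eq_iff inner_eq_Re_cinner)
  with assms(1) show ?thesis by (simp add: positive_op_def)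
qed

text \<open>Symmetry follows by polarization: the form is real at \<open>x + y\<close> and at
  \<open>x + \<i> *\<^sub>C y\<close>, which settles the imaginary and the real part of the
  claim.\<close>

lemma positive_opD:
  assumes "positive_op A"
  shows "bounded_clinear A" "cinner (A x) y = cinner x (A y)" "inner (A x) y = inner x (A y)"
    "0 \<le> inner (A x) x"
proof -
  show A: "bounded_clinear A" using assms by (simp add: positive_op_def)
  have pos: "0 \<le> Re (cinner (A x) x)" "Im (cinner (A x) x) = 0" for x
    using assms by (simp_all add: positive_op_def complex_nonneg_Reals_iff)
  show "0 \<le> inner (A x) x" using pos(1) by (simp add: inner_eq_Re_cinner)
  note expand = bounded_clinear_add[OF A] bounded_clinear_scaleC_commute[OF A]
    cinner_add_left cinner_add_right cinner_scaleC_left cinner_scaleC_right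
  have "Im (cinner (A x) y + cinner (A y) x) = 0"
    using pos(2)[of "x + y"] pos(2)[of x] pos(2)[of y] by (simp add: expand)
  moreover have "Re (cinner (A x) y - cinner (A y) x) = 0"
    using pos(2)[of "x + \<i> *\<^sub>C y"] pos(2)[of x] pos(2)[of y] by (simp add: expand)
  ultimately have "cinner (A x) y = cnj (cinner (A y) x)" by (simp add: complex_eq_iff)
  also have "\<dots> = cinner x (A y)" by (rule cinner_commute[symmetric])
  finally show "cinner (A x) y = cinner x (A y)" .
  then show "inner (A x) y = inner x (A y)" by (simp add: inner_eq_Re_cinner)
qed

lemma selfadjoint_between_positive_op:
  assumes A: "positive_op A"
  shows "selfadjoint_between 0 (onorm A) A"
proof -
  have "inner (A x) x \<le> onorm A * (norm x)\<^sup>2" for x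
    using norm_cauchy_schwarz[of "A x" x]
      mult_right_mono[OF bounded_clinear_norm_le[OF positive_opD(1)[OF A], of x] norm_ge_zero[of x]]
    by (simp add: power2_eq_square mult.assoc)
  then show ?thesis
    using positive_opD[OF A] by (simp add: selfadjoint_between_def)
qed

section \<open>Square roots by polynomial approximation\<close>

text \<open>Weierstrass approximation, phrased for complex polynomials with real coefficients:
  invariance under \<open>cnj\<close> makes their values at a self-adjoint operator
  self-adjoint.\<close>

lemma real_poly_approx:
  fixes f :: "real \<Rightarrow> real"
  assumes "continuous_on {a..b} f" "0 < e"
  obtains p where "map_poly cnj p = p"
    "\<And>t. t \<in> {a..b} \<Longrightarrow> \<exists>u. poly p (complex_of_real t) = complex_of_real u \<and> \<bar>f t - u\<bar> < e"
proof -
  obtain g where g: "real_polynomial_function g" "\<And>t. t \<in> {a..b} \<Longrightarrow> \<bar>f t - g t\<bar> < e"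
    using Stone_Weierstrass_real_polynomial_function[OF compact_Icc assms] by blast
  then obtain c n where c: "g = (\<lambda>x. \<Sum>i\<le>n. c i * x ^ i)"
    by (auto simp: real_polynomial_function_iff_sum)
  define p where "p = (\<Sum>i\<le>n. monom (complex_of_real (c i)) i)"
  have "map_poly cnj p = p"
    by (simp add: poly_eq_iff p_def coeff_map_poly coeff_sum cnj_sum if_distrib cong: if_cong)
  moreover have "poly p (complex_of_real t) = complex_of_real (g t)" for t
    by (simp add: p_def c poly_sum poly_monom)
  ultimately show ?thesis using g(2) by (intro that) auto
qed

text \<open>\<open>S\<close> is the pointwise limit of \<open>p n\<close> applied to
  \<open>A\<close>, where \<open>p n\<close> tends to the square root uniformly on
  \<open>{0..b}\<close>. Whatever commutes with \<open>A\<close> commutes with each approximant,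
  hence with \<open>S\<close>; uniqueness of the root rests on this.\<close>

lemma positive_sqrt_exists:
  fixes A :: "'a::chilbert_space \<Rightarrow> 'a"
  assumes A: "positive_op A"
  obtains S where "positive_op S" "\<And>x. S (S x) = A x"
    "\<And>C x. bounded_clinear C \<Longrightarrow> (\<And>y. C (A y) = A (C y)) \<Longrightarrow> C (S x) = S (C x)"
proof -
  define b where "b = onorm A"
  note bA = positive_opD(1)[OF A]
  note sA = selfadjoint_between_positive_op[OF A, folded b_def]
  have "0 \<le> b" unfolding b_def by (rule onorm_pos_le[OF bounded_clinear_imp_bounded_linear[OF bA]])
  define e where "e n = 1 / real (Suc n)" for n
  have e: "0 < e n" for n by (simp add: e_def)
  have e_lim: "e \<longlonglongrightarrow> 0" unfolding e_def by (intro LIMSEQ_Suc lim_1_over_n)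
  have "\<exists>p. map_poly cnj p = p \<and> (\<forall>t\<in>{0..b}. \<exists>u. poly p (complex_of_real t) = complex_of_real u
      \<and> \<bar>sqrt t - u\<bar> < e n)" for n
    by (rule real_poly_approx[of 0 b sqrt "e n"]) (use e in \<open>auto intro!: continuous_intros\<close>)
  then obtain p where p: "\<And>n. map_poly cnj (p n) = p n"
    "\<And>n t. t \<in> {0..b} \<Longrightarrow> \<exists>u. poly (p n) (complex_of_real t) = complex_of_real u
      \<and> \<bar>sqrt t - u\<bar> < e n" by metis
  define R where "R n = poly_op (p n) A" for n
  have R_bdd: "bounded_clinear (R n)" for n
    unfolding R_def by (rule bounded_clinear_poly_op[OF bA])
  have R_sym: "inner (R n x) y = inner x (R n y)" for n x y
    using cinner_poly_op[OF bA positive_opD(2)[OF A], of "p n" x y]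
    by (simp add: R_def inner_eq_Re_cinner p(1))
  \<comment> \<open>Both polynomials are compared with the square root on \<open>{0..b}\<close>, and
    the scalar estimate is carried to \<open>A\<close> by \<open>poly_op_norm_le\<close> with
    \<open>q = 1\<close>.\<close>
  have R_diff: "norm (R n x - R m x) \<le> (e n + e m) * norm x" for n m x
  proof -
    have "norm (poly_op (p n - p m) A x) \<le> (e n + e m) * norm (poly_op 1 A x)"
    proof (rule poly_op_norm_le[OF sA])
      fix t assume t: "t \<in> {0..b}"
      obtain u v where "poly (p n) (complex_of_real t) = complex_of_real u" "\<bar>sqrt t - u\<bar> < e n"
        "poly (p m) (complex_of_real t) = complex_of_real v" "\<bar>sqrt t - v\<bar> < e m"
        using p(2)[OF t] by metis
      then show "cmod (poly (p n - p m) (complex_of_real t)) \<le> (e n + e m) * cmod (poly 1 (complex_of_real t))"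
        by (simp flip: of_real_diff)
    qed (use e[of n] e[of m] in simp)
    then show ?thesis by (simp add: R_def poly_op_diff[OF bA])
  qed
  have "convergent (\<lambda>n. R n x)" for x
  proof (unfold Cauchy_convergent_iff[symmetric], rule CauchyI)
    fix d :: real assume "0 < d"
    have "(\<lambda>n. 2 * e n * norm x) \<longlonglongrightarrow> 2 * 0 * norm x" by (intro tendsto_intros e_lim)
    then have "eventually (\<lambda>n. 2 * e n * norm x < d) sequentially"
      using \<open>0 < d\<close> by (intro order_tendstoD(2)) auto
    then obtain N where N: "2 * e N * norm x < d" by (auto simp: eventually_sequentially)
    have "norm (R n x - R m x) < d" if "N \<le> n" "N \<le> m" for n m
    proof -
      have "e n + e m \<le> 2 * e N"
        using add_mono[of "e n" "e N" "e m" "e N"] that by (simp add: e_def frac_le)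
      then show ?thesis
        using R_diff[of n x m] mult_right_mono[of "e n + e m" "2 * e N" "norm x"] N by simp
    qed
    then show "\<exists>M. \<forall>m\<ge>M. \<forall>n\<ge>M. norm (R m x - R n x) < d" by blast
  qed
  then obtain S where S: "\<And>x. (\<lambda>n. R n x) \<longlonglongrightarrow> S x"
    unfolding convergent_def by metis
  have S_unique: "y = S x" if "(\<lambda>n. R n x) \<longlonglongrightarrow> y" for x y
    using that S by (rule LIMSEQ_unique)
  have S_bdd: "bounded_clinear S"
  proof (rule bounded_clinearI)
    show "S (x + y) = S x + S y" for x y
      by (rule S_unique[symmetric]) (simp add: bounded_clinear_add[OF R_bdd] tendsto_add S)
    show "S (c *\<^sub>C x) = c *\<^sub>C S x" for c x
      using bounded_linear.tendsto[OF bounded_clinear_imp_bounded_linear[OF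
          bounded_clinear_scaleC[OF bounded_clinear_id]] S, of c]
      by (intro S_unique[symmetric]) (simp add: bounded_clinear_scaleC_commute[OF R_bdd])
    \<comment> \<open>The bound is uniform in \<open>n\<close>, since \<open>e n \<le> 1\<close> and
      the square root is at most \<open>sqrt b\<close> on the interval.\<close>
    show "norm (S x) \<le> (sqrt b + 1) * norm x" for x
    proof (rule Lim_bounded[OF tendsto_norm[OF S]])
      have "norm (poly_op (p n) A x) \<le> (sqrt b + 1) * norm (poly_op 1 A x)" for n
      proof (rule poly_op_norm_le[OF sA])
        fix t assume t: "t \<in> {0..b}"
        obtain u where u: "poly (p n) (complex_of_real t) = complex_of_real u" "\<bar>sqrt t - u\<bar> < e n"
          using p(2)[OF t] by metis
        have "e n \<le> 1" by (simp add: e_def)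
        moreover have "0 \<le> sqrt t" "sqrt t \<le> sqrt b" using t by auto
        ultimately have "\<bar>u\<bar> \<le> sqrt b + 1" using u(2) by linarith
        then show "cmod (poly (p n) (complex_of_real t)) \<le> (sqrt b + 1) * cmod (poly 1 (complex_of_real t))"
          by (simp add: u(1))
      qed (use \<open>0 \<le> b\<close> in simp)
      then show "\<forall>n\<ge>0. norm (R n x) \<le> (sqrt b + 1) * norm x" by (simp add: R_def)
    qed
  qed
  have S_sym: "inner (S x) y = inner x (S y)" for x y
  proof (rule LIMSEQ_unique)
    show "(\<lambda>n. inner (R n x) y) \<longlonglongrightarrow> inner (S x) y"
      by (rule tendsto_inner[OF S tendsto_const])
    show "(\<lambda>n. inner (R n x) y) \<longlonglongrightarrow> inner x (S y)"
      unfolding R_sym by (rule tendsto_inner[OF tendsto_const S])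
  qed
  \<comment> \<open>An approximant may be negative on \<open>{0..b}\<close>, but only by less than
    \<open>e n\<close>. Adding the constant \<open>e n\<close> repairs this and vanishes in the
    limit.\<close>
  have "0 \<le> inner (S x) x" for x
  proof (rule LIMSEQ_le_const)
    show "(\<lambda>n. inner (R n x) x + e n * (norm x)\<^sup>2) \<longlonglongrightarrow> inner (S x) x"
      using tendsto_add[OF tendsto_inner[OF S tendsto_const] tendsto_mult_left_zero[OF e_lim]]
      by simp
    have "0 \<le> inner (R n x) x + e n * (norm x)\<^sup>2" for n
    proof -
      define h where "h = p n + [:complex_of_real (e n):]"
      have h: "poly_op h A y = R n y + e n *\<^sub>R y" for y
        by (simp add: h_def R_def poly_op_add[OF bA] poly_op_const scaleR_scaleC)
      have "0 \<le> inner (poly_op h A x) x"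
      proof (rule poly_op_nonneg[OF sA])
        fix t assume t: "t \<in> {0..b}"
        obtain u where u: "poly (p n) (complex_of_real t) = complex_of_real u" "\<bar>sqrt t - u\<bar> < e n"
          using p(2)[OF t] by metis
        have "0 \<le> sqrt t" using t by simp
        then have "0 \<le> u + e n" using u(2) by linarith
        then show "poly h (complex_of_real t) \<in> \<real>\<^sub>\<ge>\<^sub>0"
          by (simp add: h_def u(1) flip: of_real_add)
      qed (simp add: h R_sym inner_add_left inner_add_right)
      then show ?thesis by (simp add: h inner_add_left dot_square_norm)
    qed
    then show "\<exists>N. \<forall>n\<ge>N. 0 \<le> inner (R n x) x + e n * (norm x)\<^sup>2" by blast
  qed
  then have S_pos: "positive_op S" by (intro positive_opI S_bdd S_sym)
  have RR: "(\<lambda>n. R n (R n x)) \<longlonglongrightarrow> A x" for x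
  proof -
    have bound: "norm (R n (R n x) - A x) \<le> (e n * (2 * sqrt b + 1)) * norm x" for n
    proof -
      \<comment> \<open>The constant comes from factoring u^2 - t into (u - sqrt t) (u + sqrt t):
        the first factor is below \<open>e n\<close>, the second at most
        \<open>2 * sqrt b + 1\<close>.\<close>
      have "norm (poly_op (p n * p n - [:0, 1:]) A x) \<le> (e n * (2 * sqrt b + 1)) * norm (poly_op 1 A x)"
      proof (rule poly_op_norm_le[OF sA])
        fix t assume t: "t \<in> {0..b}"
        obtain u where u: "poly (p n) (complex_of_real t) = complex_of_real u" "\<bar>sqrt t - u\<bar> < e n"
          using p(2)[OF t] by metis
        have "e n \<le> 1" by (simp add: e_def)
        moreover have "0 \<le> sqrt t" "sqrt t \<le> sqrt b" using t by auto
        ultimately have "\<bar>u + sqrt t\<bar> \<le> 2 * sqrt b + 1" using u(2) by linarith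
        then have "\<bar>u - sqrt t\<bar> * \<bar>u + sqrt t\<bar> \<le> e n * (2 * sqrt b + 1)"
          using u(2) by (intro mult_mono) auto
        moreover have "(u - sqrt t) * (u + sqrt t) = u * u - t"
          using t by (simp add: algebra_simps)
        ultimately have "\<bar>u * u - t\<bar> \<le> e n * (2 * sqrt b + 1)"
          by (metis abs_mult)
        then show "cmod (poly (p n * p n - [:0, 1:]) (complex_of_real t))
            \<le> e n * (2 * sqrt b + 1) * cmod (poly 1 (complex_of_real t))"
          by (simp add: u(1) flip: of_real_mult of_real_diff)
      qed (use e[of n] \<open>0 \<le> b\<close> in simp)
      then show ?thesis
        by (simp add: R_def poly_op_diff[OF bA] poly_op_mult[OF bA] poly_op_linear[OF bA])
    qed
    have "(\<lambda>n. (e n * (2 * sqrt b + 1)) * norm x) \<longlonglongrightarrow> 0 * (2 * sqrt b + 1) * norm x"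
      by (intro tendsto_intros e_lim)
    then have "(\<lambda>n. (e n * (2 * sqrt b + 1)) * norm x) \<longlonglongrightarrow> 0" by simp
    with always_eventually[OF allI[OF bound]] have "(\<lambda>n. R n (R n x) - A x) \<longlonglongrightarrow> 0"
      by (rule Lim_null_comparison)
    then show ?thesis by (simp add: LIM_zero_iff)
  qed
  \<comment> \<open>The products of \<open>R n x\<close> with \<open>R n y\<close> are computed in
    two ways: factor by factor, and after moving both copies of \<open>R n\<close> to
    \<open>x\<close>.\<close>
  have "inner (S (S x)) y = inner (A x) y" for x y
  proof (rule LIMSEQ_unique)
    show "(\<lambda>n. inner (R n x) (R n y)) \<longlonglongrightarrow> inner (S (S x)) y"
      using tendsto_inner[OF S S, of x y] by (simp add: S_sym)
    show "(\<lambda>n. inner (R n x) (R n y)) \<longlonglongrightarrow> inner (A x) y"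
      using tendsto_inner[OF RR tendsto_const, of x y] by (simp add: R_sym)
  qed
  then have "S (S x) = A x" for x using vector_eq_rdot by blast
  moreover have "C (S x) = S (C x)" if "bounded_clinear C" "\<And>y. C (A y) = A (C y)" for C x
    using bounded_linear.tendsto[OF bounded_clinear_imp_bounded_linear[OF that(1)] S, of x]
    by (intro S_unique) (simp add: R_def poly_op_commute[OF bA that])
  ultimately show ?thesis using S_pos that by blast
qed

text \<open>For uniqueness, another root \<open>S'\<close> commutes with \<open>A\<close>, hence
  with \<open>S\<close>. Then \<open>S + S'\<close> kills \<open>y = S x - S' x\<close>, so both
  nonnegative forms vanish at \<open>y\<close>. Thus \<open>S y = S' y = 0\<close>, and moving
  \<open>S - S'\<close> across the product gives \<open>inner y y = 0\<close>.\<close>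

lemma sqrt_op:
  fixes A :: "'a::chilbert_space \<Rightarrow> 'a"
  assumes A: "positive_op A"
  shows "positive_op (sqrt_op A)" "sqrt_op A (sqrt_op A x) = A x"
proof -
  obtain S where S: "positive_op S" "\<And>x. S (S x) = A x"
    and comm: "\<And>C x. bounded_clinear C \<Longrightarrow> (\<And>y. C (A y) = A (C y)) \<Longrightarrow> C (S x) = S (C x)"
    using positive_sqrt_exists[OF A] by blast
  have unique: "S' = S" if S': "positive_op S'" "S' \<circ> S' = A" for S'
  proof
    fix x
    have sq: "S' (S' y) = A y" for y using S'(2) by (auto simp: fun_eq_iff)
    then have "S' (A y) = A (S' y)" for y by metis
    then have SS': "S' (S x) = S (S' x)" by (rule comm[OF positive_opD(1)[OF S'(1)]])
    define y where "y = S x - S' x"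
    have "S y + S' y = 0"
      by (simp add: y_def bounded_clinear_diff[OF positive_opD(1)[OF S(1)]]
          bounded_clinear_diff[OF positive_opD(1)[OF S'(1)]] S(2) sq SS')
    then have sum: "inner (S y) y + inner (S' y) y = 0" by (simp flip: inner_add_left)
    have "Q y = 0" if "positive_op Q" "inner (Q y) y = 0" for Q
      using positive_form_norm_le[OF positive_opD(1,3,4)[OF that(1)], of y] that(2) by simp
    then have "S y = 0" "S' y = 0"
      using S(1) S'(1) sum positive_opD(4)[OF S(1), of y] positive_opD(4)[OF S'(1), of y] by auto
    moreover have "inner y y = inner x (S y) - inner x (S' y)"
      by (subst (1) y_def) (simp add: inner_diff_left positive_opD(3)[OF S(1)] positive_opD(3)[OF S'(1)])
    ultimately show "S' x = S x" by (simp add: y_def)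
  qed
  have "S \<circ> S = A" using S(2) by auto
  with S(1) have "positive_op S \<and> S \<circ> S = A" ..
  then have "sqrt_op A = S"
    unfolding sqrt_op_def
    by (rule the_equality[where P = "\<lambda>S. positive_op S \<and> S \<circ> S = A"]) (use unique in blast)
  with S show "positive_op (sqrt_op A)" "sqrt_op A (sqrt_op A x) = A x" by simp_all
qed

section \<open>The quantum annulus\<close>

text \<open>Reading the bound on \<open>inv T\<close> as a lower bound on \<open>T\<close> leaves
  conditions that see \<open>T\<close> only through the norms of \<open>T x\<close>, apart from
  invertibility.\<close>

lemma quantum_annulus_iff:
  assumes "0 < r"
  shows "T \<in> quantum_annulus r \<longleftrightarrow> invertible_op T \<and>
    (\<forall>x. norm (T x) \<le> inverse r * norm x) \<and> (\<forall>x. norm x \<le> inverse r * norm (T x))"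
proof (cases "invertible_op T")
  case True
  note T = invertible_opD[OF True]
  have bound: "onorm (\<lambda>x. r *\<^sub>R f x) \<le> 1 \<longleftrightarrow> (\<forall>x. norm (f x) \<le> inverse r * norm x)"
    if "bounded_clinear f" for f :: "'a \<Rightarrow> 'a"
    using assms by (subst onorm_le_iff[OF bounded_clinear_scaleR[OF that]]) (simp_all add: field_simps)
  have "(\<forall>x. norm (inv T x) \<le> inverse r * norm x) \<longleftrightarrow> (\<forall>x. norm x \<le> inverse r * norm (T x))"
    by (metis T(3,4))
  with True show ?thesis
    by (simp add: quantum_annulus_def bound[OF T(1)] bound[OF T(2)])
qed (simp add: quantum_annulus_def)

text \<open>The quadratic form of the operator is a difference of squared norms. With
  \<open>S = inv T\<close> this turns condition (2) into a norm inequality.\<close>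

lemma positive_defect_iff:
  fixes T S :: "'a::chilbert_space \<Rightarrow> 'a"
  assumes T: "bounded_clinear T" and S: "bounded_clinear S"
  shows "positive_op (\<lambda>x. c *\<^sub>R x - (cadjoint T \<circ> T) x - (S \<circ> cadjoint S) x) \<longleftrightarrow>
    (\<forall>x. (norm (T x))\<^sup>2 + (norm (cadjoint S x))\<^sup>2 \<le> c * (norm x)\<^sup>2)"
proof -
  let ?D = "\<lambda>x. c *\<^sub>R x - (cadjoint T \<circ> T) x - (S \<circ> cadjoint S) x"
  have form: "inner (?D x) y = c * inner x y - inner (T x) (T y) - inner (cadjoint S x) (cadjoint S y)" for x y
    by (simp add: inner_diff_left inner_cadjoint[OF T] inner_cadjoint(1)[OF S])
  have "bounded_clinear ?D"
    unfolding o_def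
    by (intro bounded_clinear_minus bounded_clinear_scaleR[OF bounded_clinear_id]
        bounded_clinear_compose[OF bounded_clinear_cadjoint[OF T] T]
        bounded_clinear_compose[OF S bounded_clinear_cadjoint[OF S]])
  moreover have "inner (?D x) y = inner x (?D y)" for x y
    unfolding inner_commute[of x "?D y"] form by (simp add: inner_commute)
  ultimately have "positive_op ?D \<longleftrightarrow> (\<forall>x. 0 \<le> inner (?D x) x)"
    using positive_opI positive_opD(4) by blast
  then show ?thesis by (simp only: form dot_square_norm) (simp add: algebra_simps)
qed

text \<open>\<open>G\<close> is bounded below by \<open>1 / N\<close>, where \<open>N = onorm F\<close>, so \<open>N\<^sup>2 + N\<^sup>-\<^sup>2 \<le> r\<^sup>-\<^sup>2 + r\<^sup>2\<close>.\<close>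

lemma onorm_le_if_norm_sum_le:
  fixes F G :: "'a::complex_inner \<Rightarrow> 'a"
  assumes r: "0 < r" "r < 1" and F: "bounded_clinear F"
    and sum: "\<And>x. (norm (F x))\<^sup>2 + (norm (G x))\<^sup>2 \<le> (inverse (r\<^sup>2) + r\<^sup>2) * (norm x)\<^sup>2"
    and below: "\<And>x. norm x \<le> onorm F * norm (G x)"
  shows "onorm F \<le> inverse r"
proof (rule ccontr)
  define N k where "N = onorm F" and "k = inverse (r\<^sup>2) + r\<^sup>2 - inverse (N\<^sup>2)"
  assume "\<not> onorm F \<le> inverse r"
  then have N: "inverse r < N" by (simp add: N_def)
  moreover have "0 < inverse r" using r(1) by simp
  ultimately have "0 < N" by linarith
  \<comment> \<open>\<open>k\<close> is what \<open>sum\<close> leaves for \<open>F\<close> once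
    \<open>G\<close> is bounded below. Its sign is not known yet, hence the maximum;
    \<open>0 < N\<close> later rules out the value 0.\<close>
  have "norm (F x) \<le> sqrt (max k 0) * norm x" for x
  proof -
    have "(norm x)\<^sup>2 \<le> (N * norm (G x))\<^sup>2"
      using below[of x] by (intro power_mono) (auto simp: N_def)
    then have "inverse (N\<^sup>2) * (norm x)\<^sup>2 \<le> (norm (G x))\<^sup>2"
      using \<open>0 < N\<close> by (simp add: field_simps power_mult_distrib)
    with sum[of x] have "(norm (F x))\<^sup>2 \<le> k * (norm x)\<^sup>2"
      by (simp add: k_def algebra_simps)
    also have "\<dots> \<le> max k 0 * (norm x)\<^sup>2" by (intro mult_right_mono) auto
    also have "\<dots> = (sqrt (max k 0) * norm x)\<^sup>2" by (simp add: power_mult_distrib)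
    finally show ?thesis by (rule power2_le_imp_le) simp
  qed
  then have "N \<le> sqrt (max k 0)" unfolding N_def by (intro onorm_bound) auto
  then have "N\<^sup>2 \<le> (sqrt (max k 0))\<^sup>2" using \<open>0 < N\<close> by (intro power_mono) auto
  then have "N\<^sup>2 \<le> max k 0" by simp
  then have "N\<^sup>2 \<le> k" using \<open>0 < N\<close> by (auto simp: max_def split: if_splits)
  moreover have "k < N\<^sup>2"
  proof -
    have u: "inverse (r\<^sup>2) < N\<^sup>2"
      using power_strict_mono[OF N, of 2] \<open>0 < inverse r\<close> by (simp add: power_inverse)
    moreover have "1 < inverse (r\<^sup>2)" using r by (simp add: one_less_inverse power_less_one_iff)
    moreover have "r\<^sup>2 < 1" using r by (simp add: power_less_one_iff)
    \<comment> \<open>Divided by \<open>N^2\<close>, this product is \<open>N^2 + N^-2\<close> minus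
      \<open>r^-2 + r^2\<close>, that is \<open>N^2 - k\<close>.\<close>
    ultimately have "0 < (N\<^sup>2 - inverse (r\<^sup>2)) * (N\<^sup>2 - r\<^sup>2)" by (intro mult_pos_pos) linarith+
    also have "\<dots> = N\<^sup>2 * (N\<^sup>2 - k)"
      using r \<open>0 < N\<close> by (simp add: k_def field_simps)
    finally show ?thesis using \<open>0 < N\<close> by (simp add: zero_less_mult_iff)
  qed
  ultimately show False by simp
qed

lemma quantum_annulus_iff_positive_defect:
  fixes T :: "'a::chilbert_space \<Rightarrow> 'a"
  assumes r: "0 < r" "r < 1" and T: "invertible_op T"
  shows "T \<in> quantum_annulus r \<longleftrightarrow>
    positive_op (\<lambda>x. (inverse (r\<^sup>2) + r\<^sup>2) *\<^sub>R x - (cadjoint T \<circ> T) x - (inv T \<circ> cadjoint (inv T)) x)"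
    (is "?Q \<longleftrightarrow> positive_op ?D")
proof -
  note T' = invertible_opD[OF T]
  note adj = invertible_op_cadjoint[OF T]
  note adj' = invertible_opD[OF adj(1), unfolded adj(2)]
  have D: "positive_op ?D \<longleftrightarrow> (\<forall>x. (norm (T x))\<^sup>2 + (norm (cadjoint (inv T) x))\<^sup>2
      \<le> (inverse (r\<^sup>2) + r\<^sup>2) * (norm x)\<^sup>2)"
    by (rule positive_defect_iff[OF T'(1,2)])
  have norm_T: "onorm T \<le> inverse r \<longleftrightarrow> (\<forall>x. norm (T x) \<le> inverse r * norm x)"
    "onorm (inv T) \<le> inverse r \<longleftrightarrow> (\<forall>x. norm (inv T x) \<le> inverse r * norm x)"
    using r(1) by (simp_all add: onorm_le_iff T'(1,2))
  have "(\<forall>x. norm (inv T x) \<le> inverse r * norm x) \<longleftrightarrow> (\<forall>x. norm x \<le> inverse r * norm (T x))"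
    by (metis T'(3,4))
  then have Q: "?Q \<longleftrightarrow> onorm T \<le> inverse r \<and> onorm (inv T) \<le> inverse r"
    using T by (simp add: quantum_annulus_iff[OF r(1)] norm_T)
  show ?thesis
  proof
    assume "positive_op ?D"
    then have sum: "(norm (T x))\<^sup>2 + (norm (cadjoint (inv T) x))\<^sup>2 \<le> (inverse (r\<^sup>2) + r\<^sup>2) * (norm x)\<^sup>2" for x
      using D by blast
    \<comment> \<open>This is the norm bound of \<open>cadjoint T\<close> at
      \<open>cadjoint (inv T) x\<close>. Exchanging the roles of \<open>T\<close> and
      \<open>cadjoint (inv T)\<close> afterwards bounds the inverse, whose adjoint has the same
      norm.\<close>
    have "norm x \<le> onorm T * norm (cadjoint (inv T) x)" for x
      using norm_cadjoint_le[OF T'(1), of "cadjoint (inv T) x"] by (simp add: adj'(4))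
    then have "onorm T \<le> inverse r"
      by (rule onorm_le_if_norm_sum_le[OF r T'(1) sum])
    moreover have "norm x \<le> onorm (cadjoint (inv T)) * norm (T x)" for x
      using bounded_clinear_norm_le[OF T'(2), of "T x"] by (simp add: T'(3) onorm_cadjoint[OF T'(2)])
    then have "onorm (cadjoint (inv T)) \<le> inverse r"
      using sum by (intro onorm_le_if_norm_sum_le[OF r adj'(2), of T]) (simp_all add: add.commute)
    ultimately show ?Q by (simp add: Q onorm_cadjoint[OF T'(2)])
  next
    assume ?Q
    then have bounds: "onorm T \<le> inverse r" "onorm (inv T) \<le> inverse r" by (simp_all add: Q)
    define B where "B x = T (cadjoint T x)" for x
    have bB: "bounded_clinear B"
      unfolding B_def by (rule bounded_clinear_compose[OF T'(1) adj'(1)])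
    have B_form: "inner (B x) y = inner (cadjoint T x) (cadjoint T y)" for x y
      by (simp add: B_def inner_cadjoint(1)[OF T'(1)])
    have B_sym: "inner (B x) y = inner x (B y)" for x y
      by (metis B_form inner_commute)
    have sB: "selfadjoint_between (r\<^sup>2) (inverse (r\<^sup>2)) B"
      unfolding selfadjoint_between_def
    proof (intro conjI allI)
      fix x
      show "cinner (B x) y = cinner x (B y)" for y
        by (rule cinner_eq_if_inner_eq[OF bB B_sym])
      have "norm (cadjoint T x) \<le> inverse r * norm x"
        using norm_cadjoint_le[OF T'(1), of x] mult_right_mono[OF bounds(1) norm_ge_zero[of x]] by simp
      then have "(norm (cadjoint T x))\<^sup>2 \<le> (inverse r * norm x)\<^sup>2" by (intro power_mono) auto
      then show "inner (B x) x \<le> inverse (r\<^sup>2) * (norm x)\<^sup>2"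
        by (simp add: B_form dot_square_norm power_mult_distrib power_inverse)
      have "norm x \<le> inverse r * norm (cadjoint T x)"
        using norm_cadjoint_le[OF T'(2), of "cadjoint T x"]
          mult_right_mono[OF bounds(2) norm_ge_zero[of "cadjoint T x"]] by (simp add: adj'(3))
      then have "(r * norm x)\<^sup>2 \<le> (norm (cadjoint T x))\<^sup>2"
        using r(1) by (intro power_mono) (auto simp: field_simps)
      then show "r\<^sup>2 * (norm x)\<^sup>2 \<le> inner (B x) x"
        by (simp add: B_form dot_square_norm power_mult_distrib)
    qed (rule bB)
    \<comment> \<open>This is \<open>(r^-2 - t) (t - r^2)\<close> expanded, hence nonnegative
      between the bounds of \<open>B\<close>.\<close>
    define h where "h = [:- 1, complex_of_real (inverse (r\<^sup>2) + r\<^sup>2), - 1:]"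
    have h: "poly_op h B y = (inverse (r\<^sup>2) + r\<^sup>2) *\<^sub>R B y - y - B (B y)" for y
      by (simp add: h_def poly_op_pCons[OF bB] bounded_clinear_zero[OF bB] bounded_clinear_diff[OF bB]
          bounded_clinear_uminus[OF bB] bounded_clinear_scaleC_commute[OF bB] scaleR_scaleC scaleC_minus_left
          del: of_real_add of_real_inverse of_real_power)
    have "poly h (complex_of_real t) \<in> \<real>\<^sub>\<ge>\<^sub>0" if "t \<in> {r\<^sup>2..inverse (r\<^sup>2)}" for t
    proof -
      have "poly h (complex_of_real t) = complex_of_real ((inverse (r\<^sup>2) - t) * (t - r\<^sup>2))"
        using r(1) by (simp add: h_def field_simps power2_eq_square)
      then show ?thesis using that by (simp only: nonneg_Reals_of_real_iff) simp
    qed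
    moreover have "inner (poly_op h B x) y = inner x (poly_op h B y)" for x y
      by (simp add: h inner_diff_left inner_diff_right B_sym)
    ultimately have pos: "0 \<le> inner (poly_op h B y) y" for y
      by (rule poly_op_nonneg[OF sB])
    have h_pos: "(norm (B y))\<^sup>2 + (norm y)\<^sup>2 \<le> (inverse (r\<^sup>2) + r\<^sup>2) * (norm (cadjoint T y))\<^sup>2" for y
    proof -
      have "inner (B (B y)) y = (norm (B y))\<^sup>2" "inner (B y) y = (norm (cadjoint T y))\<^sup>2"
        by (simp_all only: B_sym[of "B y"] B_form[of y y] dot_square_norm)
      with pos[of y] show ?thesis
        by (simp add: h inner_diff_left dot_square_norm)
    qed
    \<comment> \<open>For \<open>y = cadjoint (inv T) x\<close> one has
      \<open>cadjoint T y = x\<close> and \<open>B y = T x\<close>, so \<open>h_pos\<close> becomes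
      the claim.\<close>
    have "(norm (T x))\<^sup>2 + (norm (cadjoint (inv T) x))\<^sup>2 \<le> (inverse (r\<^sup>2) + r\<^sup>2) * (norm x)\<^sup>2" for x
      using h_pos[of "cadjoint (inv T) x"] by (simp add: B_def adj'(4))
    then show "positive_op ?D" using D by blast
  qed
qed

section \<open>Spectral sets\<close>

text \<open>The annulus omits 0, so \<open>P\<close> is invertible, and both |z| and 1/|z| are at
  most \<open>inverse r\<close> on it.\<close>

lemma spectral_set_imp_quantum_annulus:
  fixes P :: "'a::complex_inner \<Rightarrow> 'a"
  assumes r: "0 < r" "r < 1" and P: "spectral_set (closed_annulus r) P"
  shows "P \<in> quantum_annulus r"
proof -
  let ?K = "closed_annulus r"
  have bP: "bounded_clinear P" and spec: "spectrum P \<subseteq> ?K"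
    and bound: "\<And>p q. (\<And>z. z \<in> ?K \<Longrightarrow> poly q z \<noteq> 0) \<Longrightarrow>
      onorm (poly_op p P \<circ> inv (poly_op q P)) \<le> (SUP z\<in>?K. cmod (poly p z / poly q z))"
    using P by (auto simp: spectral_set_def)
  \<comment> \<open>Here \<open>r < 1\<close> enters: the suprema below are bounded by
    \<open>cSUP_least\<close>, which requires a nonempty set.\<close>
  have "1 \<in> ?K" using r by (simp add: closed_annulus_def one_le_inverse)
  then have K_ne: "?K \<noteq> {}" by blast
  have K0: "z \<noteq> 0" if "z \<in> ?K" for z using that r by (auto simp: closed_annulus_def)
  have id: "poly_op 1 P = id" and X: "poly_op [:0, 1:] P = P"
    by (auto simp: fun_eq_iff poly_op_linear[OF bP])
  have "0 \<notin> spectrum P" using spec K0 by blast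
  then have "invertible_op (\<lambda>x. (-1) *\<^sub>C (0 *\<^sub>C x - P x))"
    by (intro invertible_op_scaleC) (simp_all add: spectrum_def)
  then have inv: "invertible_op P" by (simp add: scaleC_minus_left)
  note P' = invertible_opD[OF inv]
  have "onorm P \<le> (SUP z\<in>?K. cmod (poly [:0, 1:] z / poly 1 z))"
    using bound[of 1 "[:0, 1:]"] by (simp add: id X)
  also have "\<dots> \<le> inverse r"
    by (rule cSUP_least[OF K_ne]) (simp add: closed_annulus_def)
  finally have le: "norm (P x) \<le> inverse r * norm x" for x
    using r(1) by (simp add: onorm_le_iff[OF bP])
  have "onorm (inv P) \<le> (SUP z\<in>?K. cmod (poly 1 z / poly [:0, 1:] z))"
    using bound[of "[:0, 1:]" 1] K0 by (simp add: id X)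
  also have "\<dots> \<le> inverse r"
    using r(1)
    by (intro cSUP_least[OF K_ne]) (auto simp: closed_annulus_def norm_divide inverse_eq_divide intro: frac_le)
  finally have "norm (inv P x) \<le> inverse r * norm x" for x
    using r(1) by (simp add: onorm_le_iff[OF P'(2)])
  then have "norm x \<le> inverse r * norm (P x)" for x by (metis P'(3))
  with inv le show ?thesis by (simp add: quantum_annulus_iff[OF r(1)])
qed

text \<open>Compactness makes the supremum \<open>M\<close> of |p/q| an actual bound, so |p| <= M
  |q| on the interval. \<open>poly_op_norm_le\<close> at the vector
  \<open>inv (poly_op q P) y\<close> then bounds the quotient.\<close>

lemma selfadjoint_imp_spectral_set:
  fixes P :: "'a::chilbert_space \<Rightarrow> 'a"
  assumes P: "selfadjoint_between a b P" and K: "compact K" "K \<noteq> {}" "complex_of_real ` {a..b} \<subseteq> K"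
  shows "spectral_set K P"
  unfolding spectral_set_def
proof (intro conjI allI impI)
  show bP: "bounded_clinear P" by (rule selfadjoint_betweenD(1)[OF P])
  show spec: "spectrum P \<subseteq> K" using spectrum_selfadjoint[OF P] K(3) by blast
  fix p q :: "complex poly"
  assume q: "\<forall>z\<in>K. poly q z \<noteq> 0"
  define M where "M = (SUP z\<in>K. cmod (poly p z / poly q z))"
  have "compact ((\<lambda>z. cmod (poly p z / poly q z)) ` K)"
    using q by (intro compact_continuous_image continuous_intros K(1)) auto
  then have bdd: "bdd_above ((\<lambda>z. cmod (poly p z / poly q z)) ` K)"
    by (intro bounded_imp_bdd_above compact_imp_bounded)
  have M: "cmod (poly p z / poly q z) \<le> M" if "z \<in> K" for z
    unfolding M_def using that bdd by (intro cSUP_upper)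
  have "0 \<le> M" using K(2) M by (metis all_not_in_conv norm_ge_zero order_trans)
  have "q \<noteq> 0" using q K(2) by auto
  then have inv: "invertible_op (poly_op q P)"
    using q spec by (intro invertible_op_poly_op bP) auto
  have "norm (poly_op p P (inv (poly_op q P) y)) \<le> M * norm y" for y
  proof -
    have "cmod (poly p (complex_of_real t)) \<le> M * cmod (poly q (complex_of_real t))" if "t \<in> {a..b}" for t
    proof -
      have "complex_of_real t \<in> K" using that K(3) by blast
      then show ?thesis using M[of "complex_of_real t"] q by (auto simp: norm_divide field_simps)
    qed
    from poly_op_norm_le[OF P \<open>0 \<le> M\<close> this, of "inv (poly_op q P) y"]
    show ?thesis by (simp add: invertible_opD(4)[OF inv])
  qed
  then show "onorm (poly_op p P \<circ> inv (poly_op q P)) \<le> (SUP z\<in>K. cmod (poly p z / poly q z))"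
    unfolding M_def[symmetric] o_def using \<open>0 \<le> M\<close> by (intro onorm_bound) auto
qed (rule K(1))

lemma selfadjoint_between_quantum_annulus:
  fixes P :: "'a::complex_inner \<Rightarrow> 'a"
  assumes r: "0 < r" and P: "positive_op P" "P \<in> quantum_annulus r"
  shows "selfadjoint_between r (inverse r) P"
  unfolding selfadjoint_between_def
proof (intro conjI allI)
  note P' = positive_opD[OF P(1)]
  have inv: "invertible_op P" and le: "\<And>x. norm (P x) \<le> inverse r * norm x"
    "\<And>x. norm x \<le> inverse r * norm (P x)"
    using P(2) by (simp_all add: quantum_annulus_iff[OF r])
  show "bounded_clinear P" "cinner (P x) y = cinner x (P y)" for x y by (fact P')+
  fix x
  show "inner (P x) x \<le> inverse r * (norm x)\<^sup>2"
    using norm_cauchy_schwarz[of "P x" x] mult_right_mono[OF le(1)[of x] norm_ge_zero[of x]]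
    by (simp add: power2_eq_square mult.assoc)
  show "r * (norm x)\<^sup>2 \<le> inner (P x) x"
  proof -
    \<comment> \<open>Positivity at \<open>x - r *\<^sub>R y\<close> brings in
      \<open>inner x y\<close>, which the bound on the inverse controls; the factor \<open>r\<close>
      makes the terms add up to the lower bound.\<close>
    define y where "y = inv P x"
    have Py: "P y = x" by (simp add: y_def invertible_opD(4)[OF inv])
    have "inner x y \<le> norm x * norm y" by (rule norm_cauchy_schwarz)
    also have "\<dots> \<le> norm x * (inverse r * norm x)"
      using le(2)[of y] by (intro mult_left_mono) (auto simp: Py)
    finally have "r * inner x y \<le> (norm x)\<^sup>2" using r by (simp add: field_simps power2_eq_square)
    then have xy: "r * (r * inner x y) \<le> r * (norm x)\<^sup>2" using r by (intro mult_left_mono) auto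
    have "0 \<le> inner (P (x - r *\<^sub>R y)) (x - r *\<^sub>R y)" by (rule P'(4))
    also have "\<dots> = inner (P x) x - 2 * r * (norm x)\<^sup>2 + r * (r * inner x y)"
      using bounded_clinear_imp_bounded_linear[OF P'(1)] P'(3)[of x y]
      by (simp add: linear_simps inner_simps Py dot_square_norm algebra_simps)
    finally show ?thesis using xy by (simp add: mult.assoc)
  qed
qed

text \<open>Used to pass between \<open>T\<close> and its modulus, and from a factor
  \<open>R\<close> to \<open>T = U \<circ> R\<close>.\<close>

lemma quantum_annulus_cong_norm:
  assumes "0 < r" "invertible_op T" "\<And>x. norm (T x) = norm (P x)" "P \<in> quantum_annulus r"
  shows "T \<in> quantum_annulus r"
  using assms by (simp add: quantum_annulus_iff)

lemma compact_closed_annulus: "compact (closed_annulus r)"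
proof -
  have "closed (closed_annulus r)"
    unfolding closed_annulus_def by (intro closed_Collect_conj closed_Collect_le continuous_intros)
  moreover have "bounded (closed_annulus r)"
    unfolding bounded_iff closed_annulus_def by auto
  ultimately show ?thesis by (simp add: compact_eq_bounded_closed)
qed

lemma unitary_op_norm:
  fixes U :: "'a::chilbert_space \<Rightarrow> 'a"
  assumes "unitary_op U"
  shows "norm (U x) = norm x"
proof -
  have U: "bounded_clinear U" "cadjoint U (U x) = x"
    using assms by (auto simp: unitary_op_def fun_eq_iff)
  have "(norm (U x))\<^sup>2 = inner x (cadjoint U (U x))"
    by (simp add: inner_cadjoint(1)[OF U(1), symmetric] dot_square_norm)
  then show ?thesis by (simp add: U(2) dot_square_norm)
qed

section \<open>Polar decomposition and the equivalence of the four conditions\<close>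

theorem theorem1p7:
  fixes r :: real and T :: "'a::chilbert_space \<Rightarrow> 'a"
  assumes "0 < r" and "r < 1" and "invertible_op T"
  shows "(T \<in> quantum_annulus r
            \<longleftrightarrow> positive_op (\<lambda>x. (inverse (r\<^sup>2) + r\<^sup>2) *\<^sub>R x - (cadjoint T \<circ> T) x
                                  - (inv T \<circ> cadjoint (inv T)) x)) \<and>
         (positive_op (\<lambda>x. (inverse (r\<^sup>2) + r\<^sup>2) *\<^sub>R x - (cadjoint T \<circ> T) x
                            - (inv T \<circ> cadjoint (inv T)) x)
            \<longleftrightarrow> spectral_set (closed_annulus r) (sqrt_op (cadjoint T \<circ> T))) \<and>
         (spectral_set (closed_annulus r) (sqrt_op (cadjoint T \<circ> T))
            \<longleftrightarrow> (\<exists>P U. bounded_clinear P \<and> spectral_set (closed_annulus r) P \<and>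
                       unitary_op U \<and> T = U \<circ> P))"
    (is "(?Q \<longleftrightarrow> ?D) \<and> (?D \<longleftrightarrow> ?S) \<and> (?S \<longleftrightarrow> ?U)")
proof -
  note T = invertible_opD[OF assms(3)]
  note adj = invertible_opD[OF invertible_op_cadjoint(1)[OF assms(3)]]
  define A where "A = cadjoint T \<circ> T"
  have "positive_op A"
    unfolding A_def o_def
    by (intro positive_opI bounded_clinear_compose[OF adj(1) T(1)])
      (simp_all add: inner_cadjoint[OF T(1)] flip: inner_cadjoint(1)[OF T(1)])
  define P where "P = sqrt_op A"
  have P: "positive_op P" "\<And>x. P (P x) = A x"
    unfolding P_def using sqrt_op[OF \<open>positive_op A\<close>] by simp_all
  note P' = positive_opD[OF P(1)]
  have norm_P: "norm (T x) = norm (P x)" for x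
  proof -
    have "(norm (T x))\<^sup>2 = inner (A x) x"
      by (simp add: A_def inner_cadjoint(2)[OF T(1)] dot_square_norm)
    also have "\<dots> = (norm (P x))\<^sup>2" by (simp add: P(2)[symmetric] P'(3)[of "P x"] dot_square_norm)
    finally show ?thesis by simp
  qed
  have inv_P: "invertible_op P"
  proof (rule invertible_opI[OF P'(1)])
    \<comment> \<open>The summand 1 covers the trivial space, where
      \<open>onorm (inv T) = 0\<close>.\<close>
    show "0 < inverse (onorm (inv T) + 1)"
      using onorm_pos_le[OF bounded_clinear_imp_bounded_linear[OF T(2)]] by simp
    show "inverse (onorm (inv T) + 1) * norm x \<le> norm (P x)" for x
    proof -
      have "norm x \<le> onorm (inv T) * norm (P x)"
        using invertible_op_bounded_below[OF assms(3), of x] by (simp add: norm_P)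
      also have "\<dots> \<le> (onorm (inv T) + 1) * norm (P x)" by (intro mult_right_mono) auto
      finally show ?thesis
        using onorm_pos_le[OF bounded_clinear_imp_bounded_linear[OF T(2)]] by (simp add: field_simps)
    qed
    \<comment> \<open>\<open>P\<close> squared is \<open>A\<close>, and the inverse of
      \<open>A\<close> is \<open>inv T\<close> after \<open>inv (cadjoint T)\<close>; this exhibits
      a preimage under \<open>P\<close>.\<close>
    have "P (P (inv T (inv (cadjoint T) y))) = y" for y
      by (simp add: P(2) A_def T(4) adj(4))
    then show "surj P" by (metis surj_def)
  qed
  note P_inv = invertible_opD[OF inv_P]
  \<comment> \<open>The remaining conditions are tied to \<open>?Q\<close> by the cycle from
    \<open>?Q\<close> to \<open>?S\<close> to \<open>?U\<close> and back.\<close>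
  have "?Q \<longleftrightarrow> ?D" by (rule quantum_annulus_iff_positive_defect[OF assms])
  moreover have "?Q \<Longrightarrow> ?S"
  proof -
    assume ?Q
    then have "P \<in> quantum_annulus r"
      by (rule quantum_annulus_cong_norm[OF assms(1) inv_P norm_P[symmetric]])
    then have P_between: "selfadjoint_between r (inverse r) P"
      by (rule selfadjoint_between_quantum_annulus[OF assms(1) P(1)])
    have "1 < inverse r" using assms(1,2) by (rule one_less_inverse)
    then have "1 \<in> closed_annulus r" using assms(2) by (simp add: closed_annulus_def)
    moreover have "complex_of_real ` {r..inverse r} \<subseteq> closed_annulus r"
      using assms(1) by (auto simp: closed_annulus_def)
    ultimately have "spectral_set (closed_annulus r) P"
      by (intro selfadjoint_imp_spectral_set[OF P_between compact_closed_annulus]) auto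
    then show ?S by (simp add: P_def A_def)
  qed
  moreover have "?S \<Longrightarrow> ?U"
  proof -
    assume ?S
    \<comment> \<open>The unitary factor of the polar decomposition. Its adjoint is \<open>P\<close>
      after \<open>inv T\<close>, because \<open>A\<close> equals both
      \<open>cadjoint T \<circ> T\<close> and \<open>P \<circ> P\<close>.\<close>
    define U where "U x = T (inv P x)" for x
    have bU: "bounded_clinear U"
      unfolding U_def by (rule bounded_clinear_compose[OF T(1) P_inv(2)])
    have "cinner (U x) y = cinner x (P (inv T y))" for x y
    proof -
      have "cinner (U x) y = cinner (U x) (T (inv T y))" by (simp add: T(4))
      also have "\<dots> = cinner (A (inv P x)) (inv T y)"
        by (simp add: U_def A_def cadjoint_left[OF T(1)])
      also have "\<dots> = cinner x (P (inv T y))"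
        by (simp add: P(2)[symmetric] P_inv(4) P'(2))
      finally show ?thesis .
    qed
    then have "cadjoint U = (\<lambda>y. P (inv T y))" by (rule cadjoint_unique[OF bU])
    then have "unitary_op U"
      unfolding unitary_op_def using bU by (simp add: U_def fun_eq_iff T(3,4) P_inv(3,4))
    moreover have "T = U \<circ> P" by (simp add: U_def fun_eq_iff P_inv(3))
    ultimately show ?U using \<open>?S\<close> P'(1) unfolding P_def A_def by blast
  qed
  moreover have "?U \<Longrightarrow> ?Q"
  proof -
    assume ?U
    then obtain R U where R: "spectral_set (closed_annulus r) R" "unitary_op U" "T = U \<circ> R" by blast
    then have "norm (T x) = norm (R x)" for x by (simp add: unitary_op_norm)
    then show ?Q
      using assms spectral_set_imp_quantum_annulus[OF assms(1,2) R(1)]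
      by (intro quantum_annulus_cong_norm[of r T R])
  qed
  ultimately show ?thesis by blast
qed

end
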